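(* Let $f_{A_n}(x)$ (for $n\ge 1$), $f_{C_n}(x)$ (for $n\ge 1$) and $f_{D_n}(x)$ (for $n\ge 2$) denote the $f$-polynomials of any unimodular triangulations of the boundaries of the root polytopes $\mathcal P_{A_n}$, $\mathcal P_{C_n}$ and $\mathcal P_{D_n}$, respectively. Then $$f_{A_n}(x)=\sum_{m=0}^n \binom{n+m}{m,\,m,\,n-m}x^{n-m},$$ $$f_{C_n}(x)=\sum_{m=0}^n \frac{n\,2^{2m}}{n+m}\binom{n+m}{2m}x^{n-m},$$ $$f_{D_n}(x)=\sum_{m=0}^n\left(\frac{n\,2^{2m}}{n+m}\binom{n+m}{2m}-c_{n,m}\right)x^{n-m},$$ where $c_{n,m}=\frac{n(2n-m-1)2^{m-1}}{n-m}\binom{n-2}{m-1}$ for $0\le m<n$ (with $\binom{n-2}{-1}=0$), and $c_{n,n}=n\,2^{n-1}$, this being the value obtained by interpreting $\frac{1}{n-m}\binom{n-2}{m-1}$ as $\frac{(n-2)!}{(m-1)!\,(n-m)!}$.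
   Context: Lattices: $A_n=\{\mathbf x\in\mathbb Z^{n+1}:\sum_{i=0}^n x_i=0\}$ (coordinates indexed by $0,\dots,n$); $C_n=D_n=\{\mathbf x\in\mathbb Z^n:\sum_i x_i \text{ is even}\}$. Generating sets: $\mathcal M_{A_n}=\{\mathbf e_i-\mathbf e_j:0\le i\ne j\le n\}$, $\mathcal M_{C_n}=\{\pm2\mathbf e_i:1\le i\le n\}\cup\{\pm\mathbf e_i\pm\mathbf e_j:1\le i\neq j\le n\}$, $\mathcal M_{D_n}=\{\pm\mathbf e_i\pm\mathbf e_j:1\le i\ne j\le n\}$. Root polytopes: $\mathcal P_{A_n}=\operatorname{conv}\mathcal M_{A_n}$, $\mathcal P_{C_n}=\operatorname{conv}\mathcal M_{C_n}$, $\mathcal P_{D_n}=\operatorname{conv}\mathcal M_{D_n}$; each is $n$-dimensional and contains the origin in its (relative) interior. Unimodularity is always with respect to the corresponding root lattice $\mathcal L$ ($A_n$, $C_n$ or $D_n$): a unimodular triangulation of the boundary is a geometric simplicial complex whose union is the (relative) boundary of the polytope, whose vertices lie in $\mathcal L$, and such that the $n$ vertices of each maximal simplex form a $\mathbb Z$-basis of $\mathcal L$ (equivalently, the simplex spanned by them and the origin is unimodular in $\mathcal L$). For a simplicial complex $\Gamma$ of dimension $d$, let $f_i$ be the number of $i$-dimensional faces, with $f_{-1}=1$; the $f$-polynomial is $f_\Gamma(x)=\sum_{i=-1}^{d}f_i\,x^{d-i}$. (Here $d=n-1$.) The symbol $\binom{n+m}{m,m,n-m}$ is the multinomial coefficient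 $\frac{(n+m)!}{m!\,m!\,(n-m)!}$. *)

theory Defs
  imports "HOL-Analysis.Analysis" "HOL-Computational_Algebra.Polynomial"
begin

text \<open>
  Coordinates are indexed by a finite type: \<open>'n\<close> has \<open>n + 1\<close> elements for \<open>A\<^sub>n\<close> and \<open>n\<close>
  elements for \<open>C\<^sub>n\<close> and \<open>D\<^sub>n\<close>. The lattices are regarded as subsets of real space.
\<close>

definition lattice_A :: "(real ^ 'n) set" where
  "lattice_A = {(\<chi> i. real_of_int (z i)) | z. (\<Sum>i\<in>UNIV. z i) = 0}"

definition lattice_D :: "(real ^ 'n) set" where
  "lattice_D = {(\<chi> i. real_of_int (z i)) | z. even (\<Sum>i\<in>UNIV. z i)}"

definition lattice_C :: "(real ^ 'n) set" where
  "lattice_C = lattice_D"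

definition roots_A :: "(real ^ 'n) set" where
  "roots_A = {axis i 1 - axis j 1 | i j. i \<noteq> j}"

definition roots_D :: "(real ^ 'n) set" where
  "roots_D = {s *\<^sub>R axis i 1 + t *\<^sub>R axis j 1 | s t i j. s \<in> {1, -1} \<and> t \<in> {1, -1} \<and> i \<noteq> j}"

definition roots_C :: "(real ^ 'n) set" where
  "roots_C = {s *\<^sub>R axis i 1 | s i. s \<in> {2, -2}} \<union> roots_D"

definition polytope_A :: "(real ^ 'n) set" where
  "polytope_A = convex hull roots_A"

definition polytope_C :: "(real ^ 'n) set" where
  "polytope_C = convex hull roots_C"

definition polytope_D :: "(real ^ 'n) set" where
  "polytope_D = convex hull roots_D"

abbreviation int_scale :: "int \<Rightarrow> 'a::real_vector \<Rightarrow> 'a" where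
  "int_scale k x \<equiv> of_int k *\<^sub>R x"

lemma module_int_scale: "module (int_scale :: int \<Rightarrow> 'a::real_vector \<Rightarrow> 'a)"
  by unfold_locales (simp_all add: algebra_simps)

definition int_basis :: "'a::real_vector set \<Rightarrow> 'a set \<Rightarrow> bool" where
  "int_basis B L \<longleftrightarrow> \<not> module.dependent int_scale B \<and> module.span int_scale B = L"

definition vertices :: "'a::real_vector set \<Rightarrow> 'a set" where
  "vertices S = {v. v extreme_point_of S}"

definition maximal_simplices :: "'a set set \<Rightarrow> 'a set set" where
  "maximal_simplices T = {S \<in> T. \<forall>S'\<in>T. S \<subseteq> S' \<longrightarrow> S' = S}"

definition unimodular_boundary_triangulation ::
  "'a::euclidean_space set \<Rightarrow> 'a set \<Rightarrow> 'a set set \<Rightarrow> bool" where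
  "unimodular_boundary_triangulation L P T \<longleftrightarrow>
     simplicial_complex T \<and> \<Union>T = rel_frontier P \<and>
     (\<forall>S\<in>T. vertices S \<subseteq> L) \<and>
     (\<forall>S\<in>maximal_simplices T. int_basis (vertices S) L)"

definition complex_dim :: "'a::euclidean_space set set \<Rightarrow> int" where
  "complex_dim T = Max (aff_dim ` T)"

text \<open>
  A nonempty \<^const>\<open>simplicial_complex\<close> contains the empty face, which is the unique simplex of
  dimension \<open>-1\<close>; hence no separate convention for the face number of index \<open>-1\<close> is needed.
\<close>

definition face_number :: "'a::euclidean_space set set \<Rightarrow> int \<Rightarrow> nat" where
  "face_number T i = card {S \<in> T. i simplex S}"

lemma face_number_minus_one:
  assumes "simplicial_complex T" "T \<noteq> {}"
  shows "face_number T (-1) = 1"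
proof -
  have "{} \<in> T"
    using assms empty_face_of unfolding simplicial_complex_def by blast
  then have "{S \<in> T. (-1) simplex S} = {{}}"
    by (auto simp: simplex_minus_1)
  then show ?thesis
    by (simp add: face_number_def)
qed

definition f_polynomial :: "'a::euclidean_space set set \<Rightarrow> real poly" where
  "f_polynomial T =
     (\<Sum>i = -1..complex_dim T. monom (real (face_number T i)) (nat (complex_dim T - i)))"

text \<open>
  The case \<open>m = 0\<close> encodes that the binomial coefficient of \<open>n - 2\<close> over \<open>-1\<close> is \<open>0\<close>.
\<close>

definition c_corr :: "nat \<Rightarrow> nat \<Rightarrow> real" where
  "c_corr n m =
     (if m = n then real n * 2 ^ (n - 1)
      else if m = 0 then 0
      else real n * (2 * real n - real m - 1) * 2 ^ (m - 1) / (real n - real m)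
             * real ((n - 2) choose (m - 1)))"

end

theory Submission
  imports Defs
begin

text \<open>
  In a unimodular triangulation \<open>T\<close> of the boundary of \<open>P\<close> every lattice point of the dilate \<open>k P\<close> is a
  positive integer combination, with coefficient sum at most \<open>k\<close>, of the vertices of exactly one
  face of \<open>T\<close>. A face with \<open>m\<close> vertices admits \<open>k choose m\<close> such combinations, so the number of
  lattice points of \<open>k P\<close> is \<open>\<Sum>m. f\<^bsub>m-1\<^esub> (k choose m)\<close>, and the face numbers are the Newton
  coefficients of the Ehrhart polynomial of \<open>P\<close>. They can therefore be read off from a count of the
  integer points with bounded \<open>l\<^sub>1\<close>-norm in \<open>k P\<close>. For \<open>A\<^sub>n\<close>, pairs of nonnegative vectors of equal sum
  reduce the count to Vandermonde's identity; for \<open>C\<^sub>n\<close>, the numbers satisfy the recurrence of the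
  Chebyshev polynomials; for \<open>D\<^sub>n\<close>, one removes from the count for \<open>C\<^sub>n\<close> the points with a
  coordinate of modulus greater than \<open>k\<close>, of which each point has at most one.
\<close>

section \<open>Integer vectors of given l1-norm\<close>

text \<open>Reading \<open>k choose m\<close> as y^m turns each lattice point count into a
  polynomial in y: the Legendre polynomial P_n(1 + 2y) for A, the Chebyshev polynomial T_n(1 + 2y)
  for C, and T_n(1 + 2y) - 2n y (1 + y) (1 + 2y)^(n-2) for D. The last product is the source of
  c_{n,m}; its coefficients make sense up to m = n, where the closed form would divide by n - m. The
  variable is natural: with y = t / (1 - t), the l1-spheres in dimension n have generating series
  ((1 + t) / (1 - t))^n = (1 + 2y)^n, and the numbers \<open>k choose m\<close> have the series y^m
  / (1 - t). Power series stay in the background: their identities appear as recurrences or finite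
  convolutions. On the geometric side, the face that carries a point is found by following its ray
  from the origin to the boundary, which is met exactly once because the origin is a relative
  interior point. Unimodularity makes the rescaled barycentric coordinates integers. The dimension
  of \<open>T\<close>, on which the exponents depend, is read off as the index of the last nonzero
  Newton coefficient, less one.\<close>

definition lattice_sphere :: "int set \<Rightarrow> 'i set \<Rightarrow> nat \<Rightarrow> ('i \<Rightarrow> int) set" where
  "lattice_sphere X I r =
     {c. (\<forall>i\<in>I. c i \<in> X) \<and> (\<forall>i. i \<notin> I \<longrightarrow> c i = 0) \<and> (\<Sum>i\<in>I. \<bar>c i\<bar>) = int r}"

text \<open>Since vectors vanish outside \<open>I\<close>, they are determined by finitely many
  bounded entries, although they are functions on the whole type.\<close>

lemma finite_lattice_sphere:
  assumes "finite I"
  shows "finite (lattice_sphere X I r)"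
proof (rule finite_subset)
  show "lattice_sphere X I r \<subseteq>
      {c. \<forall>i. (i \<in> I \<longrightarrow> c i \<in> {- int r..int r}) \<and> (i \<notin> I \<longrightarrow> c i = 0)}"
  proof (rule subsetI, rule CollectI, intro allI conjI impI)
    fix c i assume c: "c \<in> lattice_sphere X I r"
    { assume "i \<in> I"
      then have "\<bar>c i\<bar> \<le> (\<Sum>i\<in>I. \<bar>c i\<bar>)"
        by (intro member_le_sum) (use assms in auto)
      then show "c i \<in> {- int r..int r}"
        using c by (auto simp: lattice_sphere_def) }
    { assume "i \<notin> I"
      then show "c i = 0"
        using c by (auto simp: lattice_sphere_def) }
  qed
  show "finite {c. \<forall>i. (i \<in> I \<longrightarrow> c i \<in> {- int r..int r}) \<and> (i \<notin> I \<longrightarrow> c i = (0::int))}"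
    using assms by (intro finite_set_of_finite_funs) auto
qed

lemma lattice_sphere_empty: "lattice_sphere X {} r = (if r = 0 then {\<lambda>_. 0} else {})"
  by (auto simp: lattice_sphere_def)

text \<open>Split by the modulus j of the coordinate \<open>a\<close>. One recursion serves positive
  coefficients on a face, weak compositions and all integer vectors; \<open>X\<close> affects only
  the weights.\<close>

lemma card_lattice_sphere_insert:
  assumes "finite I" "a \<notin> I"
  shows "card (lattice_sphere X (insert a I) r) =
    (\<Sum>j\<le>r. card {x\<in>X. \<bar>x\<bar> = int j} * card (lattice_sphere X I (r - j)))"
proof -
  let ?A = "\<lambda>j. {x\<in>X. \<bar>x\<bar> = int j} \<times> lattice_sphere X I (r - j)"
  have fin: "finite {x\<in>X. \<bar>x\<bar> = int j}" for j
    by (rule finite_subset[of _ "{- int j..int j}"]) auto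
  have sum_upd: "(\<Sum>i\<in>I. \<bar>(c(a := x)) i\<bar>) = (\<Sum>i\<in>I. \<bar>c i\<bar>)" for c :: "'a \<Rightarrow> int" and x
    by (rule sum.cong) (use assms in auto)
  have "bij_betw (\<lambda>(j, x, c). c(a := x)) (Sigma {..r} ?A) (lattice_sphere X (insert a I) r)"
  proof (rule bij_betw_byWitness[where f' = "\<lambda>c. (nat \<bar>c a\<bar>, c a, c(a := 0))"])
    show "\<forall>p\<in>Sigma {..r} ?A. (\<lambda>c. (nat \<bar>c a\<bar>, c a, c(a := 0))) (case p of (j, x, c) \<Rightarrow> c(a := x)) = p"
      using assms by (auto simp: lattice_sphere_def fun_eq_iff)
    show "\<forall>c\<in>lattice_sphere X (insert a I) r.
        (case (nat \<bar>c a\<bar>, c a, c(a := 0)) of (j, x, c) \<Rightarrow> c(a := x)) = c"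
      by auto
    show "(\<lambda>(j, x, c). c(a := x)) ` Sigma {..r} ?A \<subseteq> lattice_sphere X (insert a I) r"
      using assms by (auto simp: lattice_sphere_def sum_upd[unfolded fun_upd_def] of_nat_diff
          simp del: fun_upd_apply simp: fun_upd_def)
    show "(\<lambda>c. (nat \<bar>c a\<bar>, c a, c(a := 0))) ` lattice_sphere X (insert a I) r \<subseteq> Sigma {..r} ?A"
    proof (rule image_subsetI)
      fix c assume c: "c \<in> lattice_sphere X (insert a I) r"
      then have s: "\<bar>c a\<bar> + (\<Sum>i\<in>I. \<bar>c i\<bar>) = int r"
        using assms by (simp add: lattice_sphere_def)
      have "0 \<le> (\<Sum>i\<in>I. \<bar>c i\<bar>)" by (simp add: sum_nonneg)
      with s have le: "nat \<bar>c a\<bar> \<le> r" by linarith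
      have "c(a := 0) \<in> lattice_sphere X I (r - nat \<bar>c a\<bar>)"
        using c s le assms(2) sum_upd[of c 0]
        by (auto simp: lattice_sphere_def of_nat_diff)
      with le c show "(nat \<bar>c a\<bar>, c a, c(a := 0)) \<in> Sigma {..r} ?A"
        by (auto simp: lattice_sphere_def)
    qed
  qed
  then have "card (lattice_sphere X (insert a I) r) = card (Sigma {..r} ?A)"
    by (simp add: bij_betw_same_card)
  also have "\<dots> = (\<Sum>j\<le>r. card (?A j))"
    by (rule card_SigmaI) (auto intro!: fin finite_lattice_sphere assms)
  finally show ?thesis by (simp add: card_cartesian_product)
qed

lemma sum_atMost_rev: "(\<Sum>j\<le>r. f (r - j)) = (\<Sum>j\<le>r. f j)" for f :: "nat \<Rightarrow> 'b::comm_monoid_add"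
  by (rule sum.reindex_bij_witness[where i = "\<lambda>j. r - j" and j = "\<lambda>j. r - j"]) auto

text \<open>Stars and bars; the induction step is the hockey-stick identity.\<close>

lemma card_lattice_sphere_nonneg:
  assumes "finite I" "card I = Suc n"
  shows "card (lattice_sphere {0..} I r) = (n + r) choose n"
  using assms
proof (induction n arbitrary: I r)
  have one: "card {x\<in>{0..}. \<bar>x\<bar> = int j} = 1" for j
  proof -
    have "{x\<in>{0..}. \<bar>x\<bar> = int j} = {int j}" by auto
    then show ?thesis by simp
  qed
  {
    case 0
    then obtain a where I: "I = insert a {}" by (auto simp: card_1_singleton_iff)
    have "card (lattice_sphere {0..} I r) = (\<Sum>j\<le>r. if j = r then 1 else 0)"
      unfolding I by (subst card_lattice_sphere_insert)
      (auto simp: lattice_sphere_empty one[simplified] if_distrib[of card] intro!: sum.cong cong: if_cong)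
    then show ?case by simp
  next
    case (Suc n)
    then obtain a J where I: "I = insert a J" "a \<notin> J" "finite J" "card J = Suc n"
      by (metis card_Suc_eq_finite)
    have "card (lattice_sphere {0..} I r) = (\<Sum>j\<le>r. (n + (r - j)) choose n)"
      unfolding I by (subst card_lattice_sphere_insert) (simp_all add: I Suc.IH one[simplified])
    also have "\<dots> = (\<Sum>j\<le>r. (n + j) choose n)"
      by (rule sum_atMost_rev[of "\<lambda>j. (n + j) choose n"])
    also have "\<dots> = (Suc n + r) choose Suc n"
      using choose_rising_sum(1)[of n r] by simp
    finally show ?case .
  }
qed

text \<open>Partial sums would identify these vectors with subsets of {1..k}. The induction uses
  Pascal's rule instead: the sphere of radius \<open>Suc k\<close> over \<open>insert a I\<close> is
  as large as the ball of radius \<open>k\<close> over \<open>I\<close>.\<close>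

lemma sum_card_lattice_sphere_pos:
  assumes "finite I"
  shows "(\<Sum>r\<le>k. card (lattice_sphere {1..} I r)) = k choose card I"
  using assms
proof (induction I arbitrary: k rule: finite_induct)
  case empty
  show ?case by (simp add: lattice_sphere_empty if_distrib[of card] cong: if_cong)
next
  case (insert a I)
  have one: "card {x\<in>{1..}. \<bar>x\<bar> = int j} = (if j = 0 then 0 else 1)" for j
  proof -
    have "{x\<in>{1..}. \<bar>x\<bar> = int j} = (if j = 0 then {} else {int j})" by auto
    then show ?thesis by simp
  qed
  show ?case
  proof (induction k)
    case 0
    show ?case using insert by (simp add: card_lattice_sphere_insert one)
  next
    case (Suc k)
    have "(\<Sum>j\<le>Suc k. card {x\<in>{1..}. \<bar>x\<bar> = int j} * card (lattice_sphere {1..} I (Suc k - j)))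
        = (\<Sum>j\<le>k. card (lattice_sphere {1..} I (k - j)))"
      unfolding one by (subst sum.atMost_Suc_shift) simp
    also have "\<dots> = (\<Sum>r\<le>k. card (lattice_sphere {1..} I r))"
      by (rule sum_atMost_rev)
    finally show ?case
      using Suc insert by (simp add: card_lattice_sphere_insert insert.IH)
  qed
qed

text \<open>The coefficients of ((1 + t) / (1 - t))^n; the recursion expresses (1 - t) S_{n+1} = (1
  + t) S_n for these series S_n.\<close>

fun sphere_number :: "nat \<Rightarrow> nat \<Rightarrow> nat" where
  "sphere_number 0 r = (if r = 0 then 1 else 0)"
| "sphere_number (Suc n) 0 = 1"
| "sphere_number (Suc n) (Suc r) =
     sphere_number (Suc n) r + sphere_number n (Suc r) + sphere_number n r"

lemma sphere_number_0_right [simp]: "sphere_number n 0 = 1"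
  by (cases n) auto

text \<open>The identity S_{n+1} + S_n = 2 S_n / (1 - t), in the shape produced by splitting off one
  coordinate.\<close>

lemma sphere_number_Suc_left:
  "sphere_number (Suc n) r + sphere_number n r = 2 * (\<Sum>j\<le>r. sphere_number n j)"
  by (induction r) auto

lemma card_lattice_sphere_UNIV:
  assumes "finite I"
  shows "card (lattice_sphere UNIV I r) = sphere_number (card I) r"
  using assms
proof (induction I arbitrary: r rule: finite_induct)
  case empty
  show ?case by (simp add: lattice_sphere_empty)
next
  case (insert a I)
  have two: "card {x. \<bar>x\<bar> = int j} = (if j = 0 then 1 else 2)" for j
  proof -
    have "{x. \<bar>x\<bar> = int j} = {int j, - int j}" by auto
    then show ?thesis by (simp add: card_insert_if)
  qed
  let ?s = "sphere_number (card I)"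
  \<comment> \<open>Modulus 0 is attained once, every other modulus twice; the extra summand makes
    the weight 2 uniform.\<close>
  have "card (lattice_sphere UNIV (insert a I) r) + ?s r =
      (\<Sum>j\<le>r. (if j = 0 then 1 else 2) * ?s (r - j)) + ?s r"
    using insert by (simp add: card_lattice_sphere_insert two)
  also have "\<dots> = 2 * (\<Sum>j\<le>r. ?s (r - j))"
    by (cases r) (simp_all add: sum.atMost_Suc_shift sum_distrib_left del: sum.atMost_Suc)
  also have "(\<Sum>j\<le>r. ?s (r - j)) = (\<Sum>j\<le>r. ?s j)"
    by (rule sum_atMost_rev)
  finally show ?case
    using sphere_number_Suc_left[of "card I" r] insert by simp
qed

section \<open>Newton series and recurrences\<close>

text \<open>Stopping at \<open>k\<close> loses nothing, as \<open>k choose m\<close> vanishes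
  beyond; thus no degree bound has to be carried along.\<close>

definition newton :: "(nat \<Rightarrow> real) \<Rightarrow> nat \<Rightarrow> real" where
  "newton a k = (\<Sum>m\<le>k. a m * real (k choose m))"

lemma newton_0 [simp]: "newton a 0 = a 0"
  by (simp add: newton_def)

text \<open>By Pascal's rule the forward difference shifts the coefficients. This drives the
  inductions on \<open>k\<close> below.\<close>

lemma newton_Suc: "newton a (Suc k) = newton a k + newton (\<lambda>m. a (Suc m)) k"
proof -
  have "newton a (Suc k) = a 0 + (\<Sum>m\<le>k. a (Suc m) * real (Suc k choose Suc m))"
    unfolding newton_def by (subst sum.atMost_Suc_shift) simp
  also have "\<dots> = a 0 + (\<Sum>m\<le>k. a (Suc m) * real (k choose Suc m)) + newton (\<lambda>m. a (Suc m)) k"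
    by (simp add: newton_def algebra_simps sum.distrib)
  also have "a 0 + (\<Sum>m\<le>k. a (Suc m) * real (k choose Suc m))
      = (\<Sum>m\<le>Suc k. a m * real (k choose m))"
    by (subst sum.atMost_Suc_shift) simp
  also have "\<dots> = newton a k"
    by (simp add: newton_def)
  finally show ?thesis .
qed

lemma newton_add: "newton (\<lambda>m. a m + b m) k = newton a k + newton b k"
  by (simp add: newton_def algebra_simps sum.distrib)

lemma newton_diff: "newton (\<lambda>m. a m - b m) k = newton a k - newton b k"
  by (simp add: newton_def algebra_simps sum_subtractf)

lemma newton_cmult: "newton (\<lambda>m. c * a m) k = c * newton a k"
  by (simp add: newton_def sum_distrib_left mult.assoc)

lemma newton_eq_sum:
  assumes "\<And>m. m > n \<Longrightarrow> a m = 0"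
  shows "newton a k = (\<Sum>m\<le>n. a m * real (k choose m))"
proof -
  have "newton a k = (\<Sum>m\<le>max n k. a m * real (k choose m))"
    unfolding newton_def by (rule sum.mono_neutral_left) auto
  also have "\<dots> = (\<Sum>m\<le>n. a m * real (k choose m))"
    by (rule sum.mono_neutral_right) (use assms in auto)
  finally show ?thesis .
qed

text \<open>The system is unitriangular: the value at \<open>m\<close> involves \<open>a m\<close>
  with factor 1 and otherwise only earlier coefficients. Hence face numbers are forced by the
  lattice point counts.\<close>

lemma newton_inject:
  assumes "\<And>k. newton a k = newton b k"
  shows "a = b"
proof
  fix m
  show "a m = b m"
  proof (induction m rule: less_induct)
    case (less m)
    have "newton c m = (\<Sum>i<m. c i * real (m choose i)) + c m" for c
      by (simp add: newton_def flip: lessThan_Suc_atMost)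
    with less assms[of m] show ?case by simp
  qed
qed

text \<open>From (1 + t) / (1 - t) + (1 - t) / (1 + t) = 2 (1 + t^2) / (1 - t^2): the combination
  S_{n+2} + S_n is tied to S_{n+1} by even powers of t only, so spheres of even radius can be
  treated separately.\<close>

lemma sphere_number_three_term:
  "sphere_number (Suc (Suc n)) (Suc (Suc r)) + sphere_number n (Suc (Suc r)) =
   sphere_number (Suc (Suc n)) r + sphere_number n r
     + 2 * sphere_number (Suc n) (Suc (Suc r)) + 2 * sphere_number (Suc n) r"
  by simp

section \<open>Spheres of even radius and Chebyshev polynomials\<close>

definition even_ball_number :: "nat \<Rightarrow> nat \<Rightarrow> nat" where
  "even_ball_number n k = (\<Sum>s\<le>k. sphere_number n (2 * s))"

lemma even_ball_number_0 [simp]: "even_ball_number n 0 = 1"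
  by (simp add: even_ball_number_def)

lemma even_ball_number_Suc:
  "even_ball_number n (Suc k) = even_ball_number n k + sphere_number n (Suc (Suc (2 * k)))"
  by (simp add: even_ball_number_def)

text \<open>The three-term identity telescopes along even radii. Since spheres are differences of
  balls, this is the counterpart of T_{n+2}(x) + T_n(x) = 2 x T_{n+1}(x).\<close>

lemma sphere_number_even_rec:
  "sphere_number (Suc (Suc n)) (Suc (Suc (2 * k))) + sphere_number n (Suc (Suc (2 * k))) =
   2 * (even_ball_number (Suc n) (Suc k) + even_ball_number (Suc n) k)"
proof (induction k)
  case 0
  show ?case using sphere_number_three_term[of n 0] by (simp add: even_ball_number_Suc)
next
  case (Suc k)
  then show ?case
    using sphere_number_three_term[of n "Suc (Suc (2 * k))"]
    by (simp add: even_ball_number_Suc del: sphere_number.simps)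
qed

text \<open>
  The coefficients of \<open>T\<^sub>n (1 + 2 y)\<close> for the Chebyshev polynomial \<open>T\<^sub>n\<close>; in contrast to the form with
  the factor \<open>n / (n + m)\<close>, this one is also correct for \<open>n = m = 0\<close>.
\<close>

definition chebyshev_coeff :: "nat \<Rightarrow> nat \<Rightarrow> real" where
  "chebyshev_coeff n m =
     4 ^ m * (real ((n + m) choose (2 * m)) + real ((n + m - 1) choose (2 * m))) / 2"

text \<open>By absorption the second binomial is (n - m) / (n + m) times the first, so their sum
  acquires the factor 2n / (n + m).\<close>

lemma chebyshev_coeff_eq:
  assumes "n \<ge> 1"
  shows "chebyshev_coeff n m =
    real n * 2 ^ (2 * m) / real (n + m) * real ((n + m) choose (2 * m))"
proof (cases "m \<le> n")
  case True
  have "real (n + m) * real ((n + m - 1) choose (2 * m)) = real (n - m) * real ((n + m) choose (2 * m))"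
    using binomial_absorb_comp[of "n + m" "2 * m"] True
    by (metis of_nat_mult diff_diff_left add_diff_cancel_right' mult_2 diff_add_inverse2 diff_add_inverse)
  then have "real (n + m) * (real ((n + m) choose (2 * m)) + real ((n + m - 1) choose (2 * m)))
      = 2 * real n * real ((n + m) choose (2 * m))"
    using True by (simp add: algebra_simps of_nat_diff)
  then have "real ((n + m) choose (2 * m)) + real ((n + m - 1) choose (2 * m))
      = 2 * real n * real ((n + m) choose (2 * m)) / real (n + m)"
    using assms by (simp add: field_simps)
  then show ?thesis
    unfolding chebyshev_coeff_def by (simp add: power_mult del: of_nat_add)
next
  case False
  then show ?thesis
    by (simp add: chebyshev_coeff_def binomial_eq_0)
qed

text \<open>The identity (1 + z)^2 + 1 = z^2 + 2 (1 + z), multiplied by (1 + z)^N.\<close>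

lemma binomial_three_term:
  "(Suc (Suc N) choose Suc (Suc K)) + (N choose Suc (Suc K)) =
   (N choose K) + 2 * (Suc N choose Suc (Suc K))"
  by simp

text \<open>The Chebyshev recurrence at x = 1 + 2y; each of the two binomials in
  \<open>chebyshev_coeff\<close> satisfies it separately.\<close>

lemma chebyshev_coeff_rec:
  "chebyshev_coeff (Suc (Suc n)) (Suc m) + chebyshev_coeff n (Suc m) =
   4 * chebyshev_coeff (Suc n) m + 2 * chebyshev_coeff (Suc n) (Suc m)"
proof -
  have 1: "real (Suc (Suc (Suc (n + m))) choose Suc (Suc (2 * m))) + real (Suc (n + m) choose Suc (Suc (2 * m)))
     = real (Suc (n + m) choose (2 * m)) + 2 * real (Suc (Suc (n + m)) choose Suc (Suc (2 * m)))"
    using arg_cong[OF binomial_three_term[of "Suc (n + m)" "2 * m"], of real] by simp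
  have 2: "real (Suc (Suc (n + m)) choose Suc (Suc (2 * m))) + real ((n + m) choose Suc (Suc (2 * m)))
     = real ((n + m) choose (2 * m)) + 2 * real (Suc (n + m) choose Suc (Suc (2 * m)))"
    using arg_cong[OF binomial_three_term[of "n + m" "2 * m"], of real] by simp
  have "4 ^ m * (real (Suc (Suc (Suc (n + m))) choose Suc (Suc (2 * m))) + real (Suc (n + m) choose Suc (Suc (2 * m)))
     + (real (Suc (Suc (n + m)) choose Suc (Suc (2 * m))) + real ((n + m) choose Suc (Suc (2 * m)))))
     = 4 ^ m * (real (Suc (n + m) choose (2 * m)) + 2 * real (Suc (Suc (n + m)) choose Suc (Suc (2 * m)))
     + (real ((n + m) choose (2 * m)) + 2 * real (Suc (n + m) choose Suc (Suc (2 * m)))))"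
    unfolding 1 2 ..
  then show ?thesis
    unfolding chebyshev_coeff_def by (simp add: field_simps del: binomial_Suc_Suc)
qed

lemma chebyshev_coeff_0_right [simp]: "chebyshev_coeff n 0 = 1"
  by (simp add: chebyshev_coeff_def)

text \<open>Summation in \<open>k\<close> passes from spheres to balls. It is conditional because
  the induction below needs the ball formula for \<open>Suc n\<close> from its own
  hypothesis.\<close>

lemma even_ball_number_if_sphere_number:
  assumes "\<And>k. real (sphere_number n (Suc (Suc (2 * k)))) = newton (\<lambda>m. chebyshev_coeff n (Suc m)) k"
  shows "real (even_ball_number n k) = newton (chebyshev_coeff n) k"
  by (induction k) (simp_all add: newton_Suc even_ball_number_Suc assms)

text \<open>A two-step induction, as for T_n; the base cases reflect T_0 = 1 and T_1(1 + 2y) = 1 +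
  2y.\<close>

lemma sphere_number_even:
  "real (sphere_number n (Suc (Suc (2 * k)))) = newton (\<lambda>m. chebyshev_coeff n (Suc m)) k"
proof (induction n arbitrary: k rule: induct_nat_012)
  case 0
  have "chebyshev_coeff 0 (Suc m) = 0" for m
    by (simp add: chebyshev_coeff_def binomial_eq_0 del: binomial_Suc_Suc)
  then show ?case by (simp add: newton_def)
next
  case 1
  have "sphere_number (Suc 0) (Suc r) = 2" for r
    by (induction r) auto
  moreover have "chebyshev_coeff (Suc 0) (Suc m) = (if m = 0 then 2 else 0)" for m
    by (cases m) (simp_all add: chebyshev_coeff_def numeral_2_eq_2 binomial_eq_0)
  ultimately show ?case by (simp add: newton_eq_sum[of 0] del: sphere_number.simps)
next
  case (ge2 n)
  have "real (sphere_number (Suc (Suc n)) (Suc (Suc (2 * k)))) =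
      2 * (real (even_ball_number (Suc n) (Suc k)) + real (even_ball_number (Suc n) k))
        - real (sphere_number n (Suc (Suc (2 * k))))"
    using arg_cong[OF sphere_number_even_rec[of n k], of real] by simp
  also have "\<dots> = 4 * newton (chebyshev_coeff (Suc n)) k
       + 2 * newton (\<lambda>m. chebyshev_coeff (Suc n) (Suc m)) k
       - newton (\<lambda>m. chebyshev_coeff n (Suc m)) k"
    by (simp add: even_ball_number_if_sphere_number[OF ge2(2)] newton_Suc ge2(1))
  also have "\<dots> = newton (\<lambda>m. 4 * chebyshev_coeff (Suc n) m
       + 2 * chebyshev_coeff (Suc n) (Suc m) - chebyshev_coeff n (Suc m)) k"
    by (simp add: newton_add newton_diff newton_cmult)
  also have "(\<lambda>m. 4 * chebyshev_coeff (Suc n) m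
       + 2 * chebyshev_coeff (Suc n) (Suc m) - chebyshev_coeff n (Suc m)) =
       (\<lambda>m. chebyshev_coeff (Suc (Suc n)) (Suc m))"
    by (simp add: fun_eq_iff chebyshev_coeff_rec[symmetric])
  finally show ?case .
qed

lemma even_ball_number_eq: "real (even_ball_number n k) = newton (chebyshev_coeff n) k"
  by (rule even_ball_number_if_sphere_number[OF sphere_number_even])

section \<open>Balls restricted to one parity, and the correction term for type D\<close>

definition parity_ball_number :: "nat \<Rightarrow> nat \<Rightarrow> nat" where
  "parity_ball_number n q = (\<Sum>r | r \<le> q \<and> even (q - r). sphere_number n r)"

lemma parity_ball_number_0 [simp]: "parity_ball_number n 0 = 1"
proof -
  have "{r. r \<le> 0 \<and> even (0 - r)} = {0::nat}" by auto
  then show ?thesis by (simp add: parity_ball_number_def)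
qed

lemma parity_ball_number_1: "parity_ball_number n (Suc 0) = sphere_number n (Suc 0)"
proof -
  have "{r. r \<le> Suc 0 \<and> even (Suc 0 - r)} = {Suc 0}" by (auto simp: le_Suc_eq)
  then show ?thesis by (simp add: parity_ball_number_def)
qed

lemma parity_ball_number_Suc_Suc:
  "parity_ball_number n (Suc (Suc q)) = parity_ball_number n q + sphere_number n (Suc (Suc q))"
proof -
  have "{r. r \<le> Suc (Suc q) \<and> even (Suc (Suc q) - r)} =
      insert (Suc (Suc q)) {r. r \<le> q \<and> even (q - r)}"
    by (auto simp: le_Suc_eq Suc_diff_le)
  then show ?thesis by (simp add: parity_ball_number_def)
qed

lemma parity_ball_number_consecutive:
  "parity_ball_number n (Suc q) + parity_ball_number n q = (\<Sum>r\<le>Suc q. sphere_number n r)"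
  by (induction q) (simp_all add: parity_ball_number_1 parity_ball_number_Suc_Suc)

text \<open>Restricting to radii of the parity of q divides the generating series by 1 - t^2, which
  preserves the recurrence of the spheres.\<close>

lemma parity_ball_number_rec:
  "parity_ball_number (Suc n) (Suc q) =
   parity_ball_number (Suc n) q + parity_ball_number n (Suc q) + parity_ball_number n q"
proof (induction q)
  case 0
  show ?case by (simp add: parity_ball_number_1)
next
  case (Suc q)
  then show ?case
    using sphere_number_Suc_left[of n "Suc (Suc q)"] parity_ball_number_consecutive[of n q]
      parity_ball_number_consecutive[of n "Suc q"]
    by (simp add: parity_ball_number_Suc_Suc del: sphere_number.simps)
qed

text \<open>The coefficients of \<open>(1 + y) (1 + 2 y)\<^sup>n\<close>.\<close>

definition parity_coeff :: "nat \<Rightarrow> nat \<Rightarrow> real" where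
  "parity_coeff n m =
     2 ^ m * real (n choose m) + (if m = 0 then 0 else 2 ^ (m - 1) * real (n choose (m - 1)))"

lemma parity_coeff_rec:
  "parity_coeff (Suc n) (Suc m) = 2 * parity_coeff n m + parity_coeff n (Suc m)"
  by (cases m) (simp_all add: parity_coeff_def algebra_simps)

text \<open>The formula starts at length 1: for length 0 the numbers alternate between 1 and 0 and
  are not polynomial in \<open>q\<close>.\<close>

lemma parity_ball_number_eq:
  "real (parity_ball_number (Suc n) q) = newton (parity_coeff n) q"
proof (induction n arbitrary: q)
  case 0
  have *: "parity_ball_number 0 (Suc q) + parity_ball_number 0 q = 1" for q
    unfolding parity_ball_number_consecutive by (induction q) auto
  have "parity_coeff 0 m = (if m \<le> 1 then 1 else 0)" for m
    by (cases m) (auto simp: parity_coeff_def)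
  then have "newton (parity_coeff 0) q = real q + 1"
    by (subst newton_eq_sum[of 1]) simp_all
  moreover have "parity_ball_number (Suc 0) q = q + 1"
    by (induction q) (use * in \<open>simp_all add: parity_ball_number_rec\<close>)
  ultimately show ?case by simp
next
  case (Suc n)
  show ?case
  proof (induction q)
    case 0
    show ?case by (simp add: parity_coeff_def)
  next
    case (Suc q)
    then show ?case
      by (simp add: parity_ball_number_rec[of "Suc n"] Suc.IH \<open>\<And>q. real (parity_ball_number (Suc n) q) = _\<close>
         newton_Suc parity_coeff_rec newton_add newton_cmult)
  qed
qed

text \<open>The odd fraction in c_{n,m} arises from merging the two adjacent binomials of
  \<open>parity_coeff\<close>. The extreme cases are separate: for \<open>m = 0\<close> the second
  binomial is absent, and for \<open>Suc m = n\<close> the first one vanishes.\<close>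

lemma c_corr_Suc_eq:
  assumes "n \<ge> 2" "m < n"
  shows "c_corr n (Suc m) = 2 * real n * parity_coeff (n - 2) m"
proof -
  obtain p where n: "n = p + 2"
    using assms(1) by (metis add.commute le_Suc_ex)
  consider "m = 0" | l where "m = Suc l" "l < p" | l where "m = Suc l" "l = p"
    using assms(2) n by (cases m) force+
  then show ?thesis
  proof cases
    case 1
    then show ?thesis using n by (simp add: c_corr_def parity_coeff_def field_simps)
  next
    case (2 l)
    then obtain d where p: "p = l + Suc d"
      using less_imp_Suc_add by fastforce
    have "Suc l * (p choose Suc l) = Suc d * (p choose l)"
      using binomial_absorption[of l p] binomial_absorb_comp[of p l]
      by (simp add: p del: binomial_Suc_Suc)
    then have "real (Suc l) * real (p choose Suc l) = real (Suc d) * real (p choose l)"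
      by (metis of_nat_mult)
    then have "real (p choose Suc l) = real (Suc d) * real (p choose l) / real (Suc l)"
      by (simp add: field_simps)
    with 2 n p show ?thesis
      by (simp add: c_corr_def parity_coeff_def del: binomial_Suc_Suc) (simp add: field_simps)
  next
    case (3 l)
    with n show ?thesis
      by (simp add: c_corr_def parity_coeff_def binomial_eq_0 algebra_simps)
  qed
qed

text \<open>The factor \<open>2 * real n\<close> counts the positions and signs of a large
  coordinate; the shift to \<open>m - 1\<close> is multiplication by y and comes from summing over
  \<open>q < k\<close>.\<close>

definition root_D_coeff :: "nat \<Rightarrow> nat \<Rightarrow> real" where
  "root_D_coeff n m =
     chebyshev_coeff n m - (if m = 0 then 0 else 2 * real n * parity_coeff (n - 2) (m - 1))"

text \<open>Summation over \<open>q < k\<close> turns \<open>q choose m\<close> into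
  \<open>k choose Suc m\<close>.\<close>

lemma sum_parity_ball_number:
  "(\<Sum>q<k. real (parity_ball_number (Suc n) q)) =
     newton (\<lambda>m. if m = 0 then 0 else parity_coeff n (m - 1)) k"
  by (induction k) (simp_all add: newton_Suc parity_ball_number_eq)

section \<open>Lattice points and faces of a unimodular triangulation\<close>

text \<open>The affinely independent set spanning a simplex is recovered as its set of extreme
  points, so \<open>vertices\<close> can replace an existential choice.\<close>

lemma simplex_vertices:
  fixes S :: "'a::euclidean_space set"
  assumes "n simplex S"
  shows "finite (vertices S)" "\<not> affine_dependent (vertices S)" "convex hull (vertices S) = S"
    "int (card (vertices S)) = n + 1"
proof -
  obtain C where C: "\<not> affine_dependent C" "int (card C) = n + 1" "S = convex hull C"
    using assms by (auto simp: simplex)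
  have "vertices S = C"
    using extreme_point_of_convex_hull_affine_independent[OF C(1)]
    by (auto simp: vertices_def C(3))
  with C show "finite (vertices S)" "\<not> affine_dependent (vertices S)"
    "convex hull (vertices S) = S" "int (card (vertices S)) = n + 1"
    by (auto simp: aff_independent_finite)
qed

lemma vertices_convex_hull:
  fixes C :: "'a::euclidean_space set"
  assumes "\<not> affine_dependent C"
  shows "vertices (convex hull C) = C"
  using extreme_point_of_convex_hull_affine_independent[OF assms] by (auto simp: vertices_def)

text \<open>All that the face count uses of a root polytope. The condition \<open>nontrivial\<close>
  excludes P = {0}, whose relative boundary is empty; it ensures that \<open>T\<close> contains the
  empty face, which carries the origin.\<close>

locale unimodular_boundary =
  fixes L P :: "'a::euclidean_space set" and T :: "'a set set"
  assumes triangulation: "unimodular_boundary_triangulation L P T"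
    and convex_P: "convex P" and compact_P: "compact P"
    and zero_interior: "0 \<in> rel_interior P" and nontrivial: "\<exists>p\<in>P. p \<noteq> 0"
begin

lemma finite_T: "finite T"
  and simplex_T: "S \<in> T \<Longrightarrow> \<exists>n. n simplex S"
  and face_T: "S \<in> T \<Longrightarrow> F face_of S \<Longrightarrow> F \<in> T"
  and inter_T: "S \<in> T \<Longrightarrow> S' \<in> T \<Longrightarrow> S \<inter> S' face_of S"
  and union_T: "\<Union>T = rel_frontier P"
  using triangulation by (auto simp: unimodular_boundary_triangulation_def simplicial_complex_def)

lemma vertices_T:
  assumes "S \<in> T"
  shows "finite (vertices S)" "\<not> affine_dependent (vertices S)" "convex hull (vertices S) = S"
  using simplex_T[OF assms] simplex_vertices by blast+

lemma zero_in_P: "0 \<in> P"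
  using zero_interior rel_interior_subset by blast

lemma frontier_subset: "rel_frontier P \<subseteq> P"
  using compact_P by (simp add: compact_imp_closed rel_frontier_def closure_closed Diff_subset)

lemma shrink_in_interior:
  assumes "x \<in> P" "0 \<le> s" "s < 1"
  shows "s *\<^sub>R x \<in> rel_interior P"
  using rel_interior_convex_shrink[OF convex_P zero_interior assms(1), of "1 - s"] assms
  by (simp add: algebra_simps)

text \<open>Of two distinct frontier points on one ray, the nearer would be a shrunken copy of the
  farther and hence a relative interior point.\<close>

lemma frontier_ray_unique:
  assumes "x \<in> rel_frontier P" "s *\<^sub>R x \<in> rel_frontier P" "s > 0"
  shows "s = 1"
proof (rule ccontr)
  assume "s \<noteq> 1"
  then consider "s < 1" | "s > 1" by linarith
  then show False
  proof cases
    case 1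
    then have "s *\<^sub>R x \<in> rel_interior P"
      using shrink_in_interior[of x s] assms frontier_subset by auto
    then show False using assms(2) by (simp add: rel_frontier_def)
  next
    case 2
    then have "(1 / s) *\<^sub>R s *\<^sub>R x \<in> rel_interior P"
      using assms frontier_subset by (intro shrink_in_interior) auto
    then show False using assms 2 by (simp add: rel_frontier_def)
  qed
qed

lemma ray_meets_frontier:
  assumes "p \<in> P" "p \<noteq> 0"
  obtains d where "d \<ge> 1" "d *\<^sub>R p \<in> rel_frontier P"
proof -
  have "0 + p \<in> affine hull P" using assms by (simp add: hull_inc)
  then obtain d where d: "0 < d" "d *\<^sub>R p \<in> rel_frontier P"
    using ray_to_rel_frontier[OF compact_imp_bounded[OF compact_P] zero_interior] assms(2)
    by (metis add_0)
  have "d \<ge> 1"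
  proof (rule ccontr)
    assume "\<not> d \<ge> 1"
    then have "d *\<^sub>R p \<in> rel_interior P"
      using shrink_in_interior[OF assms(1)] d by simp
    then show False using d by (simp add: rel_frontier_def)
  qed
  with d that show thesis by blast
qed

lemma T_nonempty: "T \<noteq> {}"
  using nontrivial ray_meets_frontier union_T by blast

lemma empty_in_T: "{} \<in> T"
  using T_nonempty face_T empty_face_of by blast

lemma T_subset_frontier: "S \<in> T \<Longrightarrow> S \<subseteq> rel_frontier P"
  using union_T by blast

lemma zero_not_in_frontier: "0 \<notin> rel_frontier P"
  using zero_interior by (simp add: rel_frontier_def)

text \<open>A supporting hyperplane of \<^term>\<open>P\<close> at an interior point of the simplex contains the simplex.\<close>

lemma simplex_in_hyperplane:
  assumes "S \<in> T"
  obtains a b where "b \<noteq> 0" "\<And>x. x \<in> S \<Longrightarrow> a \<bullet> x = b"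
proof (cases "S = {}")
  case True
  then show thesis using that[of 1] by auto
next
  case False
  have conv: "convex S"
    using vertices_T(3)[OF assms] by (metis convex_convex_hull)
  with False obtain y where y: "y \<in> rel_interior S"
    using rel_interior_eq_empty by blast
  have yS: "y \<in> S" using y rel_interior_subset by blast
  have yf: "y \<in> rel_frontier P" using yS T_subset_frontier[OF assms] by blast
  then have "y \<in> P" "y \<notin> rel_interior P"
    using frontier_subset by (auto simp: rel_frontier_def)
  then obtain a where a: "\<And>x. x \<in> P \<Longrightarrow> a \<bullet> y \<le> a \<bullet> x"
    "\<And>x. x \<in> rel_interior P \<Longrightarrow> a \<bullet> y < a \<bullet> x"
    using supporting_hyperplane_rel_boundary[OF convex_P] by metis
  have "a \<bullet> y \<noteq> 0" using a(2)[OF zero_interior] by simp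
  moreover have "a \<bullet> x = a \<bullet> y" if x: "x \<in> S" for x
  proof (rule antisym)
    \<comment> \<open>The segment from \<open>x\<close> through the relative interior point
      \<open>y\<close> can be prolonged inside \<open>S\<close>; if \<open>x\<close> had a larger
      value than \<open>y\<close>, the prolonged point would fall below the minimum.\<close>
    obtain e where e: "e > 1" "(1 - e) *\<^sub>R x + e *\<^sub>R y \<in> S"
      using convex_rel_interior_iff[OF conv False, of y] y x by auto
    then have "a \<bullet> y \<le> a \<bullet> ((1 - e) *\<^sub>R x + e *\<^sub>R y)"
      using a(1) T_subset_frontier[OF assms] frontier_subset by blast
    then have "(e - 1) * (a \<bullet> x) \<le> (e - 1) * (a \<bullet> y)"
      by (simp add: inner_add_right algebra_simps)
    then show "a \<bullet> x \<le> a \<bullet> y" using e by simp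
    show "a \<bullet> y \<le> a \<bullet> x"
      using a(1) x T_subset_frontier[OF assms] frontier_subset by blast
  qed
  ultimately show thesis using that by blast
qed

text \<open>Affine independence compares only combinations with equal coefficient sums. The
  hyperplane, which misses the origin, recovers that sum from the combination itself, so the
  vertices are linearly independent.\<close>

lemma vertices_coefficients_unique:
  assumes S: "S \<in> T" and eq: "(\<Sum>v\<in>vertices S. f v *\<^sub>R v) = (\<Sum>v\<in>vertices S. g v *\<^sub>R v)"
    and v: "v \<in> vertices S"
  shows "f v = (g v :: real)"
proof -
  obtain a b where ab: "b \<noteq> 0" "\<And>x. x \<in> S \<Longrightarrow> a \<bullet> x = b"
    using simplex_in_hyperplane[OF S] by blast
  have VS: "vertices S \<subseteq> S"
    by (auto simp: vertices_def extreme_point_of_def)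
  have inner: "a \<bullet> (\<Sum>v\<in>vertices S. h v *\<^sub>R v) = b * sum h (vertices S)" for h
    using ab(2) VS by (auto simp: inner_sum_right sum_distrib_left mult.commute intro!: sum.cong)
  have "b * sum f (vertices S) = b * sum g (vertices S)"
    using inner[of f] inner[of g] eq by metis
  then have "(\<Sum>v\<in>vertices S. f v - g v) = 0"
    using ab(1) by (simp add: sum_subtractf)
  moreover have "(\<Sum>v\<in>vertices S. (f v - g v) *\<^sub>R v) = 0"
    using eq by (simp add: algebra_simps sum_subtractf)
  ultimately have "\<not> (\<exists>v\<in>vertices S. f v - g v \<noteq> 0)"
    using vertices_T(2)[OF S] affine_dependent_explicit_finite[OF vertices_T(1)[OF S]] by blast
  then show ?thesis using v by simp
qed

section \<open>Integer combinations of the vertices of a face\<close>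

lemma maximal_above:
  assumes "S \<in> T"
  obtains M where "M \<in> maximal_simplices T" "S \<subseteq> M"
  using finite_has_maximal2[OF finite_T assms] by (auto simp: maximal_simplices_def)

lemma maximal_in_T: "M \<in> maximal_simplices T \<Longrightarrow> M \<in> T"
  by (simp add: maximal_simplices_def)

lemma L_eq_combinations:
  assumes "M \<in> maximal_simplices T"
  shows "L = range (\<lambda>z :: 'a \<Rightarrow> int. \<Sum>v\<in>vertices M. real_of_int (z v) *\<^sub>R v)"
proof -
  have "module.span int_scale (vertices M) = L"
    using triangulation assms by (auto simp: unimodular_boundary_triangulation_def int_basis_def)
  then show ?thesis
    using module.span_finite[OF module_int_scale vertices_T(1)[OF maximal_in_T[OF assms]]] by simp
qed

lemma combination_in_L:
  assumes S: "S \<in> T"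
  shows "(\<Sum>v\<in>vertices S. real_of_int (z v) *\<^sub>R v) \<in> L"
proof -
  obtain M where M: "M \<in> maximal_simplices T" "S \<subseteq> M"
    using maximal_above[OF S] by blast
  note MT = maximal_in_T[OF M(1)]
  have "S face_of M"
    using inter_T[OF MT S] M(2) by (simp add: inf_absorb2)
  then have "vertices S \<subseteq> vertices M"
    by (auto simp: vertices_def extreme_point_of_face)
  then have "(\<Sum>v\<in>vertices S. real_of_int (z v) *\<^sub>R v) =
      (\<Sum>v\<in>vertices M. real_of_int (if v \<in> vertices S then z v else 0) *\<^sub>R v)"
    by (intro sum.mono_neutral_cong_left) (auto simp: vertices_T[OF MT])
  then show ?thesis
    unfolding L_eq_combinations[OF M(1)] by (auto intro: rev_image_eqI)
qed

text \<open>Strict positivity of all coefficients is what places the normalized point in the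
  relative interior and thereby singles out its face.\<close>

lemma positive_combination_in_interior:
  assumes S: "S \<in> T" and c: "c \<in> lattice_sphere {1..} (vertices S) r" and r: "r > 0"
  shows "(1 / real r) *\<^sub>R (\<Sum>v\<in>vertices S. real_of_int (c v) *\<^sub>R v) \<in> rel_interior S"
proof -
  let ?u = "\<lambda>v. real_of_int (c v) / real r"
  have pos: "c v \<ge> 1" if "v \<in> vertices S" for v
    using c that by (auto simp: lattice_sphere_def)
  have "(\<Sum>v\<in>vertices S. \<bar>c v\<bar>) = sum c (vertices S)"
    by (rule sum.cong) (use pos in \<open>auto simp: abs_of_nonneg order_trans[OF zero_le_one]\<close>)
  then have "sum c (vertices S) = int r"
    using c by (simp add: lattice_sphere_def)
  then have "real_of_int (sum c (vertices S)) = real r" by simp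
  then have "sum ?u (vertices S) = 1"
    using r by (simp add: flip: sum_divide_distrib)
  moreover have "\<forall>v\<in>vertices S. 0 < ?u v"
    using pos r by (force intro!: divide_pos_pos)
  moreover have "(\<Sum>v\<in>vertices S. ?u v *\<^sub>R v) =
      (1 / real r) *\<^sub>R (\<Sum>v\<in>vertices S. real_of_int (c v) *\<^sub>R v)"
    by (simp add: scaleR_sum_right)
  ultimately show ?thesis
    using rel_interior_convex_hull_explicit[OF vertices_T(2)[OF S]] vertices_T(3)[OF S] by auto
qed

text \<open>Radius 0 admits no normalization by \<open>1 / real r\<close>; coefficients of at least
  1 leave only the empty face, with the origin as its point.\<close>

lemma lattice_sphere_pos_0:
  assumes "S \<in> T" "c \<in> lattice_sphere {1..} (vertices S) 0"
  shows "S = {}" "c = (\<lambda>_. 0)"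
proof -
  have "c v = 0" if "v \<in> vertices S" for v
    using assms that vertices_T(1)[OF assms(1)]
    by (auto simp: lattice_sphere_def sum_nonneg_eq_0_iff)
  then have "vertices S = {}"
    using assms(2) by (force simp: lattice_sphere_def)
  then show "S = {}" "c = (\<lambda>_. 0)"
    using vertices_T(3)[OF assms(1)] assms(2) by (auto simp: lattice_sphere_def)
qed

lemma positive_combination_in_frontier:
  assumes "S \<in> T" "c \<in> lattice_sphere {1..} (vertices S) r" "r > 0"
  shows "(1 / real r) *\<^sub>R (\<Sum>v\<in>vertices S. real_of_int (c v) *\<^sub>R v) \<in> rel_frontier P"
  using positive_combination_in_interior[OF assms] rel_interior_subset T_subset_frontier[OF assms(1)]
  by blast

text \<open>Normalized by \<open>r\<close> and \<open>r'\<close>, both sides are frontier points on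
  one ray, hence equal, which settles the radius. The common point then determines the face, and the
  face determines the coefficients.\<close>

lemma positive_combination_unique:
  assumes S: "S \<in> T" and c: "c \<in> lattice_sphere {1..} (vertices S) r"
    and S': "S' \<in> T" and c': "c' \<in> lattice_sphere {1..} (vertices S') r'"
    and eq: "(\<Sum>v\<in>vertices S. real_of_int (c v) *\<^sub>R v) =
      (\<Sum>v\<in>vertices S'. real_of_int (c' v) *\<^sub>R v)" (is "?x = ?x'")
  shows "S = S'" "r = r'" "c = c'"
proof -
  have zero_iff: "(\<Sum>v\<in>vertices S. real_of_int (c v) *\<^sub>R v) = 0 \<longleftrightarrow> r = 0"
    if "S \<in> T" "c \<in> lattice_sphere {1..} (vertices S) r" for S c r
    using lattice_sphere_pos_0[of S c] positive_combination_in_frontier[OF that]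
      that zero_not_in_frontier by (cases "r = 0") auto
  have "S = S' \<and> r = r' \<and> c = c'"
  proof (cases "r = 0")
    case True
    then have "r' = 0" using zero_iff[OF S c] zero_iff[OF S' c'] eq by simp
    with True show ?thesis
      using lattice_sphere_pos_0[of S c] lattice_sphere_pos_0[of S' c'] S S' c c' by auto
  next
    case False
    then have pos: "r > 0" "r' > 0" using zero_iff[OF S c] zero_iff[OF S' c'] eq by auto
    have "(real r / real r') *\<^sub>R (1 / real r) *\<^sub>R ?x = (1 / real r') *\<^sub>R ?x'"
      using pos eq by simp
    then have "real r / real r' = 1"
      using frontier_ray_unique[OF positive_combination_in_frontier[OF S c pos(1)], of "real r / real r'"]
        positive_combination_in_frontier[OF S' c' pos(2)] pos by simp
    then have r: "r = r'" using pos by simp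
    let ?y = "(1 / real r) *\<^sub>R ?x"
    have y: "?y \<in> rel_interior S" "?y \<in> rel_interior S'"
      using positive_combination_in_interior[OF S c pos(1)]
        positive_combination_in_interior[OF S' c' pos(2)] eq r by auto
    \<comment> \<open>The intersection is a face of each simplex and meets both relative interiors;
      a face meeting the relative interior is the whole simplex.\<close>
    have "S \<subseteq> S \<inter> S'" "S' \<subseteq> S' \<inter> S"
      using subset_of_face_of[OF inter_T[OF S S'] subset_refl]
        subset_of_face_of[OF inter_T[OF S' S] subset_refl] y rel_interior_subset
      by (blast+)
    then have SS: "S = S'" by blast
    have "c v = c' v" for v
    proof (cases "v \<in> vertices S")
      case True
      then show ?thesis
        using vertices_coefficients_unique[OF S, of "\<lambda>v. real_of_int (c v)" "\<lambda>v. real_of_int (c' v)" v]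
          eq SS by simp
    next
      case False
      then show ?thesis using c c' SS by (auto simp: lattice_sphere_def)
    qed
    then show ?thesis using r SS by auto
  qed
  then show "S = S'" "r = r'" "c = c'" by auto
qed

lemma positive_combination_in_dilate:
  assumes S: "S \<in> T" and c: "c \<in> lattice_sphere {1..} (vertices S) r" and r: "r \<le> k"
  shows "\<exists>p\<in>P. (\<Sum>v\<in>vertices S. real_of_int (c v) *\<^sub>R v) = real k *\<^sub>R p"
proof (cases "r = 0")
  case True
  then show ?thesis using lattice_sphere_pos_0[of S c] S c zero_in_P
    by (auto intro!: bexI[of _ 0])
next
  case False
  let ?y = "(1 / real r) *\<^sub>R (\<Sum>v\<in>vertices S. real_of_int (c v) *\<^sub>R v)"
  have "?y \<in> P" using positive_combination_in_frontier[OF S c] False frontier_subset by auto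
  then have "(real r / real k) *\<^sub>R ?y + (1 - real r / real k) *\<^sub>R 0 \<in> P"
    using r False by (intro convexD[OF convex_P] zero_in_P) auto
  then show ?thesis using False r by (auto intro!: bexI)
qed

text \<open>At the frontier point of its ray, \<open>x\<close> gets nonnegative barycentric
  coordinates; as a lattice point it has integer coordinates over the same maximal simplex.
  Uniqueness identifies the two after rescaling.\<close>

lemma positive_combination_exists:
  assumes x: "x \<in> L" and p: "p \<in> P" "x = real k *\<^sub>R p"
  shows "\<exists>S\<in>T. \<exists>r\<le>k. \<exists>c\<in>lattice_sphere {1..} (vertices S) r.
    x = (\<Sum>v\<in>vertices S. real_of_int (c v) *\<^sub>R v)"
proof (cases "x = 0")
  case True
  have v: "vertices {} = {}" by (simp add: vertices_def extreme_point_of_def)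
  show ?thesis
    using True v by (intro bexI[OF _ empty_in_T] exI[of _ 0]) (auto simp: v lattice_sphere_empty)
next
  case False
  then have k: "k > 0" and p0: "p \<noteq> 0" using p by auto
  obtain d where d: "d \<ge> 1" "d *\<^sub>R p \<in> rel_frontier P"
    using ray_meets_frontier[OF p(1) p0] by blast
  then obtain S0 where "S0 \<in> T" "d *\<^sub>R p \<in> S0" using union_T by blast
  then obtain M where M: "M \<in> maximal_simplices T" "d *\<^sub>R p \<in> M"
    using maximal_above by blast
  note MT = maximal_in_T[OF M(1)]
  let ?V = "vertices M"
  have "d *\<^sub>R p \<in> convex hull ?V" using M(2) vertices_T(3)[OF MT] by simp
  then obtain u where u: "\<forall>v\<in>?V. 0 \<le> u v" "sum u ?V = 1" "(\<Sum>v\<in>?V. u v *\<^sub>R v) = d *\<^sub>R p"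
    unfolding convex_hull_finite[OF vertices_T(1)[OF MT]] by auto
  obtain z :: "'a \<Rightarrow> int" where z: "x = (\<Sum>v\<in>?V. real_of_int (z v) *\<^sub>R v)"
    using x unfolding L_eq_combinations[OF M(1)] by auto
  \<comment> \<open>The factor that takes the frontier point back to \<open>x\<close>, hence the
    coefficient sum of \<open>x\<close>; the bound \<open>t \<le> real k\<close> is due to
    \<open>d \<ge> 1\<close>.\<close>
  define t where "t = real k / d"
  have t: "t > 0" "t \<le> real k" using d k by (auto simp: t_def divide_le_eq)
  have "(\<Sum>v\<in>?V. (t * u v) *\<^sub>R v) = t *\<^sub>R d *\<^sub>R p"
    by (simp add: scaleR_sum_right flip: u(3))
  also have "\<dots> = x" using d by (simp add: t_def p)
  finally have zu: "t * u v = real_of_int (z v)" if "v \<in> ?V" for v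
    using vertices_coefficients_unique[OF MT _ that] z by simp
  have znn: "z v \<ge> 0" if "v \<in> ?V" for v
    using zu[OF that] u(1) t that by (metis mult_nonneg_nonneg less_imp_le of_int_0_le_iff)
  have "t = (\<Sum>v\<in>?V. t * u v)" by (simp add: u(2) flip: sum_distrib_left)
  also have "\<dots> = real_of_int (sum z ?V)" by (simp add: zu)
  finally have tz: "t = real_of_int (sum z ?V)" .
  \<comment> \<open>Dropping the zero coefficients passes from the maximal simplex to the face that
    carries \<open>x\<close> in its relative interior.\<close>
  define V where "V = {v\<in>?V. z v \<noteq> 0}"
  have indep: "\<not> affine_dependent V"
    using affine_dependent_subset[of V ?V] vertices_T(2)[OF MT] by (auto simp: V_def)
  have "convex hull V face_of convex hull ?V"
    unfolding face_of_convex_hull_affine_independent[OF vertices_T(2)[OF MT]]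
    by (intro exI[of _ V]) (auto simp: V_def)
  then have VT: "convex hull V \<in> T"
    using face_T[OF MT] vertices_T(3)[OF MT] by simp
  define c where "c v = (if v \<in> V then z v else 0)" for v
  have sumV: "sum z V = sum z ?V"
    unfolding V_def by (rule sum.mono_neutral_left) (auto simp: vertices_T[OF MT])
  have "(\<Sum>v\<in>V. \<bar>c v\<bar>) = sum z V"
    by (rule sum.cong) (use znn in \<open>auto simp: c_def V_def\<close>)
  moreover have "sum z ?V = int (nat (sum z ?V))" by (simp add: znn sum_nonneg)
  moreover have "c v \<ge> 1" if "v \<in> V" for v
    using znn[of v] that by (auto simp: c_def V_def)
  ultimately have c: "c \<in> lattice_sphere {1..} V (nat (sum z ?V))"
    using sumV by (auto simp: lattice_sphere_def c_def)
  have "x = (\<Sum>v\<in>V. real_of_int (c v) *\<^sub>R v)"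
    unfolding z V_def c_def by (rule sum.mono_neutral_cong_right) (auto simp: vertices_T[OF MT])
  moreover have "nat (sum z ?V) \<le> k" using tz t by linarith
  ultimately show ?thesis
    using VT c vertices_convex_hull[OF indep] by metis
qed

lemma card_lattice_points:
  "card {x\<in>L. \<exists>p\<in>P. x = real k *\<^sub>R p} = (\<Sum>S\<in>T. k choose card (vertices S))"
proof -
  let ?D = "SIGMA S:T. SIGMA r:{..k}. lattice_sphere {1..} (vertices S) r"
  let ?f = "\<lambda>(S, r, c). \<Sum>v\<in>vertices S. real_of_int (c v) *\<^sub>R v"
  have "bij_betw ?f ?D {x\<in>L. \<exists>p\<in>P. x = real k *\<^sub>R p}"
    unfolding bij_betw_def
  proof
    show "inj_on ?f ?D"
    proof (rule inj_onI)
      fix p q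
      assume pq: "p \<in> ?D" "q \<in> ?D" "?f p = ?f q"
      obtain S r c S' r' c' where eqs: "p = (S, r, c)" "q = (S', r', c')"
        by (metis prod_cases3)
      have "S \<in> T" "c \<in> lattice_sphere {1..} (vertices S) r"
        "S' \<in> T" "c' \<in> lattice_sphere {1..} (vertices S') r'"
        "(\<Sum>v\<in>vertices S. real_of_int (c v) *\<^sub>R v) =
         (\<Sum>v\<in>vertices S'. real_of_int (c' v) *\<^sub>R v)"
        using pq by (auto simp: eqs)
      from positive_combination_unique[OF this] show "p = q"
        by (simp add: eqs)
    qed
    have "x \<in> ?f ` ?D" if xp: "x \<in> L" "p \<in> P" "x = real k *\<^sub>R p" for x p
    proof -
      obtain S r c where "S \<in> T" "r \<le> k" "c \<in> lattice_sphere {1..} (vertices S) r"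
        "x = (\<Sum>v\<in>vertices S. real_of_int (c v) *\<^sub>R v)"
        using positive_combination_exists[OF xp] by blast
      then show ?thesis by (intro image_eqI[of _ _ "(S, r, c)"]) auto
    qed
    moreover have "?f ` ?D \<subseteq> {x\<in>L. \<exists>p\<in>P. x = real k *\<^sub>R p}"
      by (auto intro!: combination_in_L) (rule positive_combination_in_dilate)
    ultimately show "?f ` ?D = {x\<in>L. \<exists>p\<in>P. x = real k *\<^sub>R p}"
      by blast
  qed
  then have "card {x\<in>L. \<exists>p\<in>P. x = real k *\<^sub>R p} = card ?D"
    by (simp add: bij_betw_same_card)
  also have "\<dots> = (\<Sum>S\<in>T. \<Sum>r\<le>k. card (lattice_sphere {1..} (vertices S) r))"
    by (simp add: finite_T finite_lattice_sphere vertices_T)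
  also have "\<dots> = (\<Sum>S\<in>T. k choose card (vertices S))"
    by (rule sum.cong) (simp_all add: sum_card_lattice_sphere_pos vertices_T)
  finally show ?thesis .
qed

section \<open>From lattice point counts to the f-polynomial\<close>

lemma simplex_iff_card:
  assumes "S \<in> T"
  shows "(int m - 1) simplex S \<longleftrightarrow> card (vertices S) = m"
proof -
  obtain n where n: "n simplex S" using simplex_T[OF assms] by blast
  then have "n = int (card (vertices S)) - 1" using simplex_vertices(4)[OF n] by simp
  moreover have "i = n" if "i simplex S" for i
    using simplex_vertices(4)[OF n] simplex_vertices(4)[OF that] by simp
  ultimately have "(int m - 1) simplex S \<longleftrightarrow> int m - 1 = int (card (vertices S)) - 1"
    using n by metis
  then show ?thesis by auto
qed

lemma card_lattice_points_newton:
  "real (card {x\<in>L. \<exists>p\<in>P. x = real k *\<^sub>R p}) = newton (\<lambda>m. real (face_number T (int m - 1))) k"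
proof -
  \<comment> \<open>Faces with more than \<open>k\<close> vertices contribute 0 on both sides, so
    \<open>m\<close> can stop at \<open>k\<close>.\<close>
  have "real (card {x\<in>L. \<exists>p\<in>P. x = real k *\<^sub>R p}) =
      (\<Sum>S\<in>T. \<Sum>m\<le>k. if card (vertices S) = m then real (k choose m) else 0)"
    unfolding card_lattice_points of_nat_sum
    by (rule sum.cong) (auto simp: binomial_eq_0)
  also have "\<dots> = (\<Sum>m\<le>k. \<Sum>S\<in>T. if card (vertices S) = m then real (k choose m) else 0)"
    by (rule sum.swap)
  also have "\<dots> = (\<Sum>m\<le>k. real (face_number T (int m - 1)) * real (k choose m))"
  proof (rule sum.cong)
    fix m
    have "{S\<in>T. card (vertices S) = m} = {S\<in>T. (int m - 1) simplex S}"
      using simplex_iff_card by blast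
    then show "(\<Sum>S\<in>T. if card (vertices S) = m then real (k choose m) else 0) =
        real (face_number T (int m - 1)) * real (k choose m)"
      by (simp add: face_number_def finite_T flip: sum.inter_filter)
  qed simp
  finally show ?thesis by (simp add: newton_def)
qed

text \<open>The last nonzero \<open>F n\<close> yields a simplex with \<open>n\<close> vertices and
  excludes larger ones; this fixes \<open>complex_dim T\<close>, and with it the exponents.\<close>

lemma f_polynomial_eqI:
  assumes count: "\<And>k. real (card {x\<in>L. \<exists>p\<in>P. x = real k *\<^sub>R p}) = newton F k"
    and nz: "F n \<noteq> 0" and zero: "\<And>m. m > n \<Longrightarrow> F m = 0"
  shows "f_polynomial T = (\<Sum>m = 0..n. monom (F m) (n - m))"
proof -
  have "(\<lambda>m. real (face_number T (int m - 1))) = F"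
    by (rule newton_inject) (metis count card_lattice_points_newton)
  then have F: "real (face_number T (int m - 1)) = F m" for m
    by metis
  have dim: "complex_dim T = int n - 1"
    unfolding complex_dim_def
  proof (rule Max_eqI)
    show "finite (aff_dim ` T)" using finite_T by simp
    fix d assume "d \<in> aff_dim ` T"
    then obtain S where S: "S \<in> T" "d = aff_dim S" by blast
    have s: "(int (card (vertices S)) - 1) simplex S" using simplex_iff_card[OF S(1)] by simp
    then have "S \<in> {S\<in>T. (int (card (vertices S)) - 1) simplex S}" using S by simp
    then have "face_number T (int (card (vertices S)) - 1) \<noteq> 0"
      using finite_T by (auto simp: face_number_def)
    then have "F (card (vertices S)) \<noteq> 0" using F by (metis of_nat_eq_0_iff)
    then have "card (vertices S) \<le> n" using zero by (meson not_le)
    then show "d \<le> int n - 1" using S aff_dim_simplex[OF s] by simp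
  next
    have "face_number T (int n - 1) \<noteq> 0" using F[of n] nz by auto
    then obtain S where "S \<in> T" "(int n - 1) simplex S"
      unfolding face_number_def by (metis (mono_tags, lifting) card.empty empty_Collect_eq)
    then show "int n - 1 \<in> aff_dim ` T"
      using aff_dim_simplex by (metis image_eqI)
  qed
  have "f_polynomial T = (\<Sum>m = 0..n. monom (real (face_number T (int m - 1))) (nat (int n - 1 - (int m - 1))))"
    unfolding f_polynomial_def dim
    by (rule sum.reindex_bij_witness[where i = "\<lambda>m. int m - 1" and j = "\<lambda>i. nat (i + 1)"]) auto
  also have "\<dots> = (\<Sum>m = 0..n. monom (F m) (n - m))"
    by (rule sum.cong) (auto simp: F nat_diff_distrib)
  finally show ?thesis .
qed

end

section \<open>Inequalities for the root polytopes\<close>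

text \<open>Contrapositive of strict separation. It reduces each description of a root polytope to
  exhibiting, for every functional, a root that does not exceed the given point.\<close>

lemma convex_hull_finite_memI:
  fixes x :: "'a::euclidean_space"
  assumes "finite R" "\<And>a. \<exists>v\<in>R. a \<bullet> v \<le> a \<bullet> x"
  shows "x \<in> convex hull R"
proof (rule ccontr)
  assume "x \<notin> convex hull R"
  moreover have "closed (convex hull R)"
    using assms(1) by (simp add: compact_convex_hull compact_imp_closed finite_imp_compact)
  ultimately obtain a b where "a \<bullet> x < b" "\<forall>y\<in>convex hull R. a \<bullet> y > b"
    using separating_hyperplane_closed_point[of "convex hull R" x] by auto
  then have "a \<bullet> x < a \<bullet> v" if "v \<in> R" for v
    using that by (meson hull_inc less_trans)
  with assms(2)[of a] show False by (meson not_le)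
qed

text \<open>The origin is the midpoint of a relative interior point and its negative.\<close>

lemma zero_in_rel_interior_symmetric:
  fixes P :: "'a::euclidean_space set"
  assumes "convex P" "P \<noteq> {}" "\<And>x. x \<in> P \<Longrightarrow> - x \<in> P"
  shows "0 \<in> rel_interior P"
proof -
  obtain y where y: "y \<in> rel_interior P"
    using assms(1,2) rel_interior_eq_empty by blast
  then have "- y \<in> P" using assms(3) rel_interior_subset by blast
  then have "- y - (1/2) *\<^sub>R (- y - y) \<in> rel_interior P"
    using rel_interior_convex_shrink[OF assms(1) y] by simp
  moreover have "- y - (1/2) *\<^sub>R (- y - y) = 0"
    by (simp add: algebra_simps flip: scaleR_add_left)
  ultimately show ?thesis by simp
qed

definition l1_norm :: "real ^ 'n \<Rightarrow> real" where
  "l1_norm x = (\<Sum>i\<in>UNIV. \<bar>x $ i\<bar>)"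

lemma l1_norm_nonneg [simp]: "l1_norm x \<ge> 0"
  by (simp add: l1_norm_def sum_nonneg)

lemma l1_norm_scaleR: "l1_norm (c *\<^sub>R x) = \<bar>c\<bar> * l1_norm x"
  by (simp add: l1_norm_def abs_mult sum_distrib_left)

lemma l1_norm_minus [simp]: "l1_norm (- x) = l1_norm x"
  by (simp add: l1_norm_def)

lemma l1_norm_zero [simp]: "l1_norm 0 = 0"
  by (simp add: l1_norm_def)

lemma l1_norm_triangle: "l1_norm (x + y) \<le> l1_norm x + l1_norm y"
  by (simp add: l1_norm_def sum_mono flip: sum.distrib)

lemma l1_norm_axis [simp]: "l1_norm (axis i s) = \<bar>s\<bar>"
  by (simp add: l1_norm_def axis_def if_distrib[of abs] cong: if_cong)

lemma component_le_l1_norm: "\<bar>x $ i\<bar> \<le> l1_norm x"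
  unfolding l1_norm_def by (rule member_le_sum) auto

lemma l1_norm_le_0_iff: "l1_norm x \<le> 0 \<longleftrightarrow> x = 0"
proof
  assume "l1_norm x \<le> 0"
  then show "x = 0"
    using component_le_l1_norm[of x] by (auto simp: vec_eq_iff) (meson abs_le_zero_iff order_trans)
qed (simp add: l1_norm_def)

lemma convex_l1_ball: "convex {x. l1_norm x \<le> c}"
proof (rule convexI, simp)
  fix x y :: "real ^ 'a" and u v :: real
  assume h: "l1_norm x \<le> c" "l1_norm y \<le> c" "0 \<le> u" "0 \<le> v" "u + v = 1"
  have "l1_norm (u *\<^sub>R x + v *\<^sub>R y) \<le> u * l1_norm x + v * l1_norm y"
    using l1_norm_triangle[of "u *\<^sub>R x" "v *\<^sub>R y"] h by (simp add: l1_norm_scaleR)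
  also have "\<dots> \<le> u * c + v * c" using h by (intro add_mono mult_left_mono) auto
  also have "\<dots> = c" using h by (simp flip: distrib_right)
  finally show "l1_norm (u *\<^sub>R x + v *\<^sub>R y) \<le> c" .
qed

lemma convex_cube: "convex {x :: real ^ 'n. \<forall>i. \<bar>x $ i\<bar> \<le> c}"
proof (rule convexI, simp, rule allI)
  fix x y :: "real ^ 'n" and u v :: real and i
  assume h: "\<forall>i. \<bar>x $ i\<bar> \<le> c" "\<forall>i. \<bar>y $ i\<bar> \<le> c" "0 \<le> u" "0 \<le> v" "u + v = 1"
  have "\<bar>u * x $ i + v * y $ i\<bar> \<le> u * \<bar>x $ i\<bar> + v * \<bar>y $ i\<bar>"
    using abs_triangle_ineq[of "u * x $ i" "v * y $ i"] h by (simp add: abs_mult)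
  also have "\<dots> \<le> u * c + v * c" using h by (intro add_mono mult_left_mono) auto
  also have "\<dots> = c" using h by (simp flip: distrib_right)
  finally show "\<bar>u * x $ i + v * y $ i\<bar> \<le> c" .
qed

lemma convex_sum_zero: "convex {x :: real ^ 'n. (\<Sum>i\<in>UNIV. x $ i) = 0}"
  by (rule convexI) (simp add: sum.distrib flip: sum_distrib_left)

lemma exists_maximum:
  fixes f :: "'i::finite \<Rightarrow> real"
  obtains i where "\<And>j. f j \<le> f i"
proof -
  have "Max (range f) \<in> range f" by (rule Max_in) auto
  then obtain i where "f i = Max (range f)" by force
  then show thesis using that[of i] by simp
qed

lemma finite_roots_A: "finite (roots_A :: (real ^ 'n) set)"
proof (rule finite_subset)
  show "roots_A \<subseteq> (\<lambda>(i, j). axis i 1 - axis j 1) ` (UNIV :: ('n \<times> 'n) set)"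
    by (auto simp: roots_A_def)
qed simp

lemma finite_roots_D: "finite (roots_D :: (real ^ 'n) set)"
proof (rule finite_subset)
  show "roots_D \<subseteq> (\<lambda>(s, t, i, j). s *\<^sub>R axis i 1 + t *\<^sub>R axis j 1) `
      ({1, -1} \<times> {1, -1} \<times> (UNIV :: ('n \<times> 'n) set))"
    unfolding roots_D_def by (rule subsetI) (force simp: image_iff)
qed simp

lemma finite_roots_C: "finite (roots_C :: (real ^ 'n) set)"
proof -
  have "{s *\<^sub>R axis i 1 | s i. s \<in> {2, -2}} \<subseteq>
      (\<lambda>(s, i). s *\<^sub>R axis i 1) ` ({2, -2} \<times> (UNIV :: 'n set))"
    by (rule subsetI) (force simp: image_iff)
  then have "finite {s *\<^sub>R axis i 1 :: real ^ 'n | s i. s \<in> {2, -2}}"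
    by (rule finite_subset) simp
  then show ?thesis by (simp add: roots_C_def finite_roots_D)
qed

lemma other_index:
  fixes i :: "'n::finite"
  assumes "CARD('n) \<ge> 2"
  obtains j where "j \<noteq> i"
proof -
  have "UNIV \<noteq> {i}"
  proof
    assume "UNIV = {i}"
    then have "CARD('n) = 1" by (metis card_1_singleton_iff One_nat_def)
    with assms show False by simp
  qed
  then show thesis using that by auto
qed

text \<open>The minimizing root is e_i - e_j with \<open>a\<close> smallest at \<open>i\<close> and
  largest at \<open>j\<close>; the bound is Hoelder's inequality after centering
  \<open>a\<close>.\<close>

lemma polytope_A_eq:
  assumes "CARD('n) \<ge> 2"
  shows "(polytope_A :: (real ^ 'n) set) = {x. (\<Sum>i\<in>UNIV. x $ i) = 0 \<and> l1_norm x \<le> 2}"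
proof
  have "v \<in> {x. (\<Sum>i\<in>UNIV. x $ i) = 0} \<inter> {x. l1_norm x \<le> 2}" if root: "v \<in> roots_A" for v :: "real ^ 'n"
  proof -
    obtain i j where v: "v = axis i 1 - axis j 1" using root by (auto simp: roots_A_def)
    have "l1_norm v \<le> 2"
      using l1_norm_triangle[of "axis i 1" "- axis j 1"] by (simp add: v)
    moreover have "(\<Sum>i\<in>UNIV. v $ i) = 0"
      by (simp add: v sum_subtractf axis_def)
    ultimately show ?thesis by simp
  qed
  then have "convex hull roots_A \<subseteq> {x :: real ^ 'n. (\<Sum>i\<in>UNIV. x $ i) = 0} \<inter> {x. l1_norm x \<le> 2}"
    by (intro hull_minimal convex_Int convex_sum_zero convex_l1_ball) auto
  then show "(polytope_A :: (real ^ 'n) set) \<subseteq> {x. (\<Sum>i\<in>UNIV. x $ i) = 0 \<and> l1_norm x \<le> 2}"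
    by (auto simp: polytope_A_def)
next
  show "{x. (\<Sum>i\<in>UNIV. x $ i) = 0 \<and> l1_norm x \<le> 2} \<subseteq> (polytope_A :: (real ^ 'n) set)"
  proof (clarify, unfold polytope_A_def, rule convex_hull_finite_memI[OF finite_roots_A])
    fix x a :: "real ^ 'n"
    assume x: "(\<Sum>i\<in>UNIV. x $ i) = 0" "l1_norm x \<le> 2"
    obtain j0 where j0: "\<And>l. a $ l \<le> a $ j0" using exists_maximum[of "\<lambda>l. a $ l"] by blast
    obtain i where i: "\<And>l. a $ i \<le> a $ l" using exists_maximum[of "\<lambda>l. - a $ l"] by auto
    \<comment> \<open>For a constant functional the two extremal indices may coincide; any other
      index then serves.\<close>
    obtain j where j: "j \<noteq> i" "\<And>l. a $ l \<le> a $ j"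
    proof (cases "j0 = i")
      case True
      obtain j where "j \<noteq> i" using other_index[OF assms] .
      moreover have "a $ l \<le> a $ j" for l using i[of j] j0[of l] True by simp
      ultimately show thesis using that by blast
    qed (use j0 that in blast)
    \<comment> \<open>The midrange of \<open>a\<close>: subtracting it leaves the inner product
      unchanged because the coordinates of \<open>x\<close> sum to zero, and minimizes the largest
      modulus.\<close>
    define M where "M = (a $ i + a $ j) / 2"
    have le: "\<bar>a $ l - M\<bar> \<le> (a $ j - a $ i) / 2" for l
      using i[of l] j(2)[of l] by (simp add: M_def abs_le_iff field_simps)
    have "a \<bullet> x = (\<Sum>l\<in>UNIV. (a $ l - M) * x $ l)"
      using x(1) by (simp add: inner_vec_def algebra_simps sum_subtractf flip: sum_distrib_left)
    also have "\<dots> \<ge> (\<Sum>l\<in>UNIV. - ((a $ j - a $ i) / 2 * \<bar>x $ l\<bar>))"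
    proof (rule sum_mono)
      fix l
      have "\<bar>(a $ l - M) * x $ l\<bar> \<le> (a $ j - a $ i) / 2 * \<bar>x $ l\<bar>"
        unfolding abs_mult by (rule mult_right_mono[OF le]) simp
      then show "- ((a $ j - a $ i) / 2 * \<bar>x $ l\<bar>) \<le> (a $ l - M) * x $ l" by linarith
    qed
    also have "(\<Sum>l\<in>UNIV. - ((a $ j - a $ i) / 2 * \<bar>x $ l\<bar>)) = - ((a $ j - a $ i) / 2 * l1_norm x)"
      by (simp add: l1_norm_def sum_negf sum_distrib_left)
    finally have "- ((a $ j - a $ i) / 2 * l1_norm x) \<le> a \<bullet> x" .
    moreover have "(a $ j - a $ i) / 2 * l1_norm x \<le> (a $ j - a $ i) / 2 * 2"
      using x(2) i[of j] by (intro mult_left_mono) auto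
    ultimately have "a \<bullet> (axis i 1 - axis j 1) \<le> a \<bullet> x"
      by (simp add: inner_diff_right inner_axis)
    moreover have "axis i 1 - axis j 1 \<in> (roots_A :: (real ^ 'n) set)"
      using j(1) by (auto simp: roots_A_def)
    ultimately show "\<exists>v\<in>roots_A. a \<bullet> v \<le> a \<bullet> x" by blast
  qed
qed

lemma roots_D_memI:
  "s \<in> {1, -1} \<Longrightarrow> t \<in> {1, -1} \<Longrightarrow> i \<noteq> j \<Longrightarrow> s *\<^sub>R axis i 1 + t *\<^sub>R axis j 1 \<in> roots_D"
  unfolding roots_D_def by blast

lemma roots_D_bounds:
  assumes "v \<in> roots_D"
  shows "l1_norm v \<le> 2" "\<bar>v $ l\<bar> \<le> 1"
proof -
  obtain s t i j where v: "v = s *\<^sub>R axis i 1 + t *\<^sub>R axis j 1" "\<bar>s\<bar> = 1" "\<bar>t\<bar> = 1" "i \<noteq> j"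
    using assms by (force simp: roots_D_def)
  show "l1_norm v \<le> 2"
    using l1_norm_triangle[of "s *\<^sub>R axis i 1" "t *\<^sub>R axis j 1"] v by (simp add: l1_norm_scaleR)
  show "\<bar>v $ l\<bar> \<le> 1"
    using v by (auto simp: axis_def)
qed

lemma inner_ge_sum_abs: "a \<bullet> x \<ge> - (\<Sum>l\<in>UNIV. \<bar>a $ l\<bar> * \<bar>x $ l\<bar>)"
proof -
  have "(\<Sum>l\<in>UNIV. - (\<bar>a $ l\<bar> * \<bar>x $ l\<bar>)) \<le> (\<Sum>l\<in>UNIV. a $ l * x $ l)"
    by (rule sum_mono) (metis abs_mult abs_ge_minus_self minus_le_iff)
  then show ?thesis by (simp add: inner_vec_def sum_negf)
qed

text \<open>The roots \<pm>e_i \<pm> e_j are midpoints of roots \<pm>2e_i, so the hull is a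
  cross-polytope.\<close>

lemma polytope_C_eq: "(polytope_C :: (real ^ 'n) set) = {x. l1_norm x \<le> 2}"
proof
  have "l1_norm v \<le> 2" if "v \<in> roots_C" for v :: "real ^ 'n"
    using that roots_D_bounds(1) by (auto simp: roots_C_def l1_norm_scaleR)
  then show "polytope_C \<subseteq> {x :: real ^ 'n. l1_norm x \<le> 2}"
    unfolding polytope_C_def by (intro hull_minimal convex_l1_ball) auto
next
  show "{x. l1_norm x \<le> 2} \<subseteq> (polytope_C :: (real ^ 'n) set)"
  proof (clarify, unfold polytope_C_def, rule convex_hull_finite_memI[OF finite_roots_C])
    fix x a :: "real ^ 'n"
    assume x: "l1_norm x \<le> 2"
    obtain i where i: "\<And>l. \<bar>a $ l\<bar> \<le> \<bar>a $ i\<bar>"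
      using exists_maximum[of "\<lambda>l. \<bar>a $ l\<bar>"] by blast
    define s :: real where "s = (if a $ i \<ge> 0 then -2 else 2)"
    have "(\<Sum>l\<in>UNIV. \<bar>a $ l\<bar> * \<bar>x $ l\<bar>) \<le> (\<Sum>l\<in>UNIV. \<bar>a $ i\<bar> * \<bar>x $ l\<bar>)"
      by (intro sum_mono mult_right_mono i) auto
    also have "\<dots> = \<bar>a $ i\<bar> * l1_norm x"
      by (simp add: l1_norm_def sum_distrib_left)
    also have "\<dots> \<le> \<bar>a $ i\<bar> * 2"
      using x by (intro mult_left_mono) auto
    finally have "- (\<bar>a $ i\<bar> * 2) \<le> a \<bullet> x"
      using inner_ge_sum_abs[of a x] by linarith
    moreover have "a \<bullet> (s *\<^sub>R axis i 1) = - (\<bar>a $ i\<bar> * 2)"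
      by (simp add: s_def inner_axis)
    moreover have "s \<in> {2, -2}"
      by (simp add: s_def)
    then have "s *\<^sub>R axis i 1 \<in> (roots_C :: (real ^ 'n) set)"
      unfolding roots_C_def by blast
    ultimately show "\<exists>v\<in>roots_C. a \<bullet> v \<le> a \<bullet> x" by metis
  qed
qed

text \<open>With mass at most 2 and at most 1 per coordinate, a functional is extremal when unit
  mass sits on its two entries of largest modulus, which is a root.\<close>

lemma polytope_D_eq:
  assumes "CARD('n) \<ge> 2"
  shows "(polytope_D :: (real ^ 'n) set) = {x. l1_norm x \<le> 2 \<and> (\<forall>i. \<bar>x $ i\<bar> \<le> 1)}"
proof
  have "convex hull roots_D \<subseteq> {x :: real ^ 'n. l1_norm x \<le> 2} \<inter> {x. \<forall>i. \<bar>x $ i\<bar> \<le> 1}"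
    using roots_D_bounds by (intro hull_minimal convex_Int convex_l1_ball convex_cube) auto
  then show "polytope_D \<subseteq> {x :: real ^ 'n. l1_norm x \<le> 2 \<and> (\<forall>i. \<bar>x $ i\<bar> \<le> 1)}"
    by (auto simp: polytope_D_def)
next
  show "{x. l1_norm x \<le> 2 \<and> (\<forall>i. \<bar>x $ i\<bar> \<le> 1)} \<subseteq> (polytope_D :: (real ^ 'n) set)"
  proof (clarify, unfold polytope_D_def, rule convex_hull_finite_memI[OF finite_roots_D])
    fix x a :: "real ^ 'n"
    assume x: "l1_norm x \<le> 2" "\<forall>i. \<bar>x $ i\<bar> \<le> 1"
    obtain i where i: "\<And>l. \<bar>a $ l\<bar> \<le> \<bar>a $ i\<bar>"
      using exists_maximum[of "\<lambda>l. \<bar>a $ l\<bar>"] by blast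
    \<comment> \<open>The value -1 lies below every modulus and so keeps \<open>i\<close> out of the
      competition; \<open>j\<close> is the runner-up.\<close>
    obtain j where j: "\<And>l. (if l = i then -1 else \<bar>a $ l\<bar>) \<le> (if j = i then -1 else \<bar>a $ j\<bar>)"
      using exists_maximum[of "\<lambda>l. if l = i then -1 else \<bar>a $ l\<bar>"] by blast
    obtain q where "q \<noteq> i" using other_index[OF assms] .
    then have ji: "j \<noteq> i" using j[of q] by (auto split: if_splits)
    have jmax: "\<bar>a $ l\<bar> \<le> \<bar>a $ j\<bar>" if "l \<noteq> i" for l
      using j[of l] ji that by simp
    define s t :: real where "s = (if a $ i \<ge> 0 then -1 else 1)" and "t = (if a $ j \<ge> 0 then -1 else 1)"
    have rest: "(\<Sum>l\<in>UNIV - {i}. \<bar>x $ l\<bar>) = l1_norm x - \<bar>x $ i\<bar>"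
      by (simp add: l1_norm_def sum_diff1)
    have "(\<Sum>l\<in>UNIV. \<bar>a $ l\<bar> * \<bar>x $ l\<bar>) =
        \<bar>a $ i\<bar> * \<bar>x $ i\<bar> + (\<Sum>l\<in>UNIV - {i}. \<bar>a $ l\<bar> * \<bar>x $ l\<bar>)"
      by (simp add: sum.remove[of _ i])
    also have "(\<Sum>l\<in>UNIV - {i}. \<bar>a $ l\<bar> * \<bar>x $ l\<bar>) \<le> (\<Sum>l\<in>UNIV - {i}. \<bar>a $ j\<bar> * \<bar>x $ l\<bar>)"
      by (intro sum_mono mult_right_mono jmax) auto
    also have "\<dots> = \<bar>a $ j\<bar> * (l1_norm x - \<bar>x $ i\<bar>)"
      by (simp add: rest flip: sum_distrib_left)
    also have "\<dots> \<le> \<bar>a $ j\<bar> * (2 - \<bar>x $ i\<bar>)"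
      using x by (intro mult_left_mono) auto
    finally have "(\<Sum>l\<in>UNIV. \<bar>a $ l\<bar> * \<bar>x $ l\<bar>) \<le>
        (\<bar>a $ i\<bar> - \<bar>a $ j\<bar>) * \<bar>x $ i\<bar> + 2 * \<bar>a $ j\<bar>"
      by (simp add: algebra_simps)
    \<comment> \<open>Here the cube inequality at \<open>i\<close> enters; the factor is nonnegative
      by the choice of \<open>i\<close>.\<close>
    also have "\<dots> \<le> (\<bar>a $ i\<bar> - \<bar>a $ j\<bar>) * 1 + 2 * \<bar>a $ j\<bar>"
      using x i[of j] by (intro add_right_mono mult_left_mono) auto
    also have "\<dots> = \<bar>a $ i\<bar> + \<bar>a $ j\<bar>"
      by simp
    finally have "- (\<bar>a $ i\<bar> + \<bar>a $ j\<bar>) \<le> a \<bullet> x"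
      using inner_ge_sum_abs[of a x] by linarith
    moreover have "a \<bullet> (s *\<^sub>R axis i 1 + t *\<^sub>R axis j 1) = - (\<bar>a $ i\<bar> + \<bar>a $ j\<bar>)"
      by (simp add: s_def t_def inner_axis inner_add_right)
    moreover have "s *\<^sub>R axis i 1 + t *\<^sub>R axis j 1 \<in> (roots_D :: (real ^ 'n) set)"
      using ji by (intro roots_D_memI) (auto simp: s_def t_def)
    ultimately show "\<exists>v\<in>roots_D. a \<bullet> v \<le> a \<bullet> x" by metis
  qed
qed

text \<open>Scaling back by \<open>1 / real k\<close> requires \<open>k > 0\<close>; the dilate by 0
  is the origin alone and has its own hypothesis.\<close>

lemma dilate_iff:
  fixes x :: "'a::real_vector"
  assumes "\<And>p. p \<in> P \<Longrightarrow> Q (real k *\<^sub>R p)" "Q x \<Longrightarrow> k > 0 \<Longrightarrow> (1 / real k) *\<^sub>R x \<in> P"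
    "Q x \<Longrightarrow> k = 0 \<Longrightarrow> x = 0" "0 \<in> P"
  shows "(\<exists>p\<in>P. x = real k *\<^sub>R p) \<longleftrightarrow> Q x"
proof
  assume Q: "Q x"
  show "\<exists>p\<in>P. x = real k *\<^sub>R p"
  proof (cases "k = 0")
    case True
    then show ?thesis using assms(3)[OF Q] assms(4) by auto
  next
    case False
    then show ?thesis using assms(2)[OF Q] by (intro bexI[of _ "(1 / real k) *\<^sub>R x"]) auto
  qed
qed (use assms(1) in auto)

lemma dilate_polytope_A_iff:
  assumes "CARD('n) \<ge> 2"
  shows "(\<exists>p\<in>polytope_A. (x :: real ^ 'n) = real k *\<^sub>R p) \<longleftrightarrow>
    (\<Sum>i\<in>UNIV. x $ i) = 0 \<and> l1_norm x \<le> 2 * real k"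
  by (rule dilate_iff)
    (auto simp: polytope_A_eq[OF assms] l1_norm_scaleR l1_norm_le_0_iff divide_le_eq mult.commute
      mult_left_mono simp flip: sum_distrib_left sum_divide_distrib)

lemma dilate_polytope_C_iff:
  "(\<exists>p\<in>polytope_C. (x :: real ^ 'n) = real k *\<^sub>R p) \<longleftrightarrow> l1_norm x \<le> 2 * real k"
  by (rule dilate_iff)
    (auto simp: polytope_C_eq l1_norm_scaleR l1_norm_le_0_iff divide_le_eq mult.commute
      mult_left_mono)

lemma dilate_polytope_D_iff:
  assumes "CARD('n) \<ge> 2"
  shows "(\<exists>p\<in>polytope_D. (x :: real ^ 'n) = real k *\<^sub>R p) \<longleftrightarrow>
    l1_norm x \<le> 2 * real k \<and> (\<forall>i. \<bar>x $ i\<bar> \<le> real k)"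
  by (rule dilate_iff)
    (auto simp: polytope_D_eq[OF assms] l1_norm_scaleR l1_norm_le_0_iff divide_le_eq mult.commute
      mult_left_mono abs_mult mult_left_le)

section \<open>The root polytopes as instances of the locale\<close>

lemma unimodular_boundary_symmetric_hull:
  fixes R :: "'a::euclidean_space set"
  assumes "unimodular_boundary_triangulation L (convex hull R) T" "finite R"
    "\<And>x. x \<in> convex hull R \<Longrightarrow> - x \<in> convex hull R" "r \<in> R" "r \<noteq> 0"
  shows "unimodular_boundary L (convex hull R) T"
proof
  show "0 \<in> rel_interior (convex hull R)"
    using assms(3,4) by (intro zero_in_rel_interior_symmetric) auto
  show "\<exists>p\<in>convex hull R. p \<noteq> 0"
    using assms(4,5) by (meson hull_inc)
qed (use assms in \<open>simp_all add: compact_convex_hull finite_imp_compact\<close>)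

lemma unimodular_boundary_A:
  assumes "CARD('n) \<ge> 2"
    "unimodular_boundary_triangulation lattice_A (polytope_A :: (real ^ 'n) set) T"
  shows "unimodular_boundary lattice_A polytope_A T"
proof -
  obtain i j :: 'n where ij: "j \<noteq> i" using other_index[OF assms(1), of undefined] by metis
  have "axis i 1 - axis j 1 \<in> (roots_A :: (real ^ 'n) set)" using ij by (auto simp: roots_A_def)
  moreover have "axis i 1 - axis j 1 \<noteq> (0 :: real ^ 'n)"
    using ij by (auto simp: axis_eq_axis)
  moreover have "- x \<in> convex hull roots_A" if "x \<in> convex hull roots_A" for x :: "real ^ 'n"
    using that unfolding polytope_A_def[symmetric] polytope_A_eq[OF assms(1)] by (simp add: sum_negf)
  ultimately show ?thesis
    using unimodular_boundary_symmetric_hull[OF assms(2)[unfolded polytope_A_def] finite_roots_A]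
    unfolding polytope_A_def by blast
qed

lemma unimodular_boundary_C:
  assumes "unimodular_boundary_triangulation lattice_C (polytope_C :: (real ^ 'n) set) T"
  shows "unimodular_boundary lattice_C polytope_C T"
proof -
  have "2 *\<^sub>R axis undefined 1 \<in> (roots_C :: (real ^ 'n) set)" by (auto simp: roots_C_def)
  moreover have "2 *\<^sub>R axis undefined 1 \<noteq> (0 :: real ^ 'n)" by (simp add: axis_eq_0_iff)
  moreover have "- x \<in> convex hull roots_C" if "x \<in> convex hull roots_C" for x :: "real ^ 'n"
    using that unfolding polytope_C_def[symmetric] polytope_C_eq by simp
  ultimately show ?thesis
    using unimodular_boundary_symmetric_hull[OF assms[unfolded polytope_C_def] finite_roots_C]
    unfolding polytope_C_def by blast
qed

lemma unimodular_boundary_D: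
  assumes "CARD('n) \<ge> 2"
    "unimodular_boundary_triangulation lattice_D (polytope_D :: (real ^ 'n) set) T"
  shows "unimodular_boundary lattice_D polytope_D T"
proof -
  obtain i j :: 'n where ij: "j \<noteq> i" using other_index[OF assms(1), of undefined] by metis
  have "1 *\<^sub>R axis i 1 + 1 *\<^sub>R axis j 1 \<in> (roots_D :: (real ^ 'n) set)"
    using ij by (intro roots_D_memI) auto
  moreover have "1 *\<^sub>R axis i 1 + 1 *\<^sub>R axis j 1 \<noteq> (0 :: real ^ 'n)"
    using ij by (auto simp: vec_eq_iff axis_def)
  moreover have "- x \<in> convex hull roots_D" if "x \<in> convex hull roots_D" for x :: "real ^ 'n"
    using that unfolding polytope_D_def[symmetric] polytope_D_eq[OF assms(1)] by simp
  ultimately show ?thesis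
    using unimodular_boundary_symmetric_hull[OF assms(2)[unfolded polytope_D_def] finite_roots_D]
    unfolding polytope_D_def by blast
qed

section \<open>Lattice points of the dilated root polytopes\<close>

lemma card_lattice_dilate:
  fixes L P :: "(real ^ 'n) set"
  assumes "L = {(\<chi> i. real_of_int (z i)) | z. R z}"
    "\<And>z. (\<exists>p\<in>P. (\<chi> i. real_of_int (z i)) = real k *\<^sub>R p) \<longleftrightarrow> Q z"
  shows "card {x\<in>L. \<exists>p\<in>P. x = real k *\<^sub>R p} = card {z. R z \<and> Q z}"
proof -
  have "bij_betw (\<lambda>z. \<chi> i. real_of_int (z i)) {z. R z \<and> Q z} {x\<in>L. \<exists>p\<in>P. x = real k *\<^sub>R p}"
    unfolding bij_betw_def
  proof
    show "inj_on (\<lambda>z. \<chi> i. real_of_int (z i)) {z. R z \<and> Q z}"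
      by (rule inj_onI) (auto simp: vec_eq_iff)
    show "(\<lambda>z. \<chi> i. real_of_int (z i)) ` {z. R z \<and> Q z} = {x\<in>L. \<exists>p\<in>P. x = real k *\<^sub>R p}"
    proof (intro equalityI subsetI)
      fix x assume "x \<in> {x\<in>L. \<exists>p\<in>P. x = real k *\<^sub>R p}"
      then obtain z where z: "x = (\<chi> i. real_of_int (z i))" "R z" and "\<exists>p\<in>P. x = real k *\<^sub>R p"
        unfolding assms(1) by blast
      then have "Q z" using assms(2)[of z] by simp
      with z
      show "x \<in> (\<lambda>z. \<chi> i. real_of_int (z i)) ` {z. R z \<and> Q z}" by blast
    next
      fix x assume "x \<in> (\<lambda>z. \<chi> i. real_of_int (z i)) ` {z. R z \<and> Q z}"
      then obtain z where z: "x = (\<chi> i. real_of_int (z i))" "R z" "Q z" by blast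
      with assms(2)[of z] show "x \<in> {x\<in>L. \<exists>p\<in>P. x = real k *\<^sub>R p}"
        unfolding assms(1) by blast
    qed
  qed
  then show ?thesis by (simp add: bij_betw_same_card)
qed

lemma l1_norm_of_int_le_iff:
  "l1_norm (\<chi> i. real_of_int (z i)) \<le> 2 * real k \<longleftrightarrow> (\<Sum>i\<in>UNIV. \<bar>z i\<bar>) \<le> 2 * int k"
proof -
  have "l1_norm (\<chi> i. real_of_int (z i)) = real_of_int (\<Sum>i\<in>UNIV. \<bar>z i\<bar>)"
    by (simp add: l1_norm_def)
  moreover have "2 * real k = real_of_int (2 * int k)" by simp
  ultimately show ?thesis by (metis of_int_le_iff)
qed

text \<open>An integer and its modulus have equal parity, so membership in the lattice depends on
  the l1-norm only.\<close>

lemma even_sum_abs_iff: "even (\<Sum>i\<in>I. \<bar>z i :: int\<bar>) \<longleftrightarrow> even (\<Sum>i\<in>I. z i)"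
  by (induction I rule: infinite_finite_induct) auto

lemma card_lattice_C_dilate:
  "card {x\<in>lattice_C. \<exists>p\<in>polytope_C. (x :: real ^ 'n) = real k *\<^sub>R p} =
     card {z :: 'n \<Rightarrow> int. even (\<Sum>i\<in>UNIV. z i) \<and> (\<Sum>i\<in>UNIV. \<bar>z i\<bar>) \<le> 2 * int k}"
  by (rule card_lattice_dilate[OF lattice_C_def[unfolded lattice_D_def]])
    (simp add: dilate_polytope_C_iff l1_norm_of_int_le_iff)

lemma card_lattice_D_dilate:
  assumes "CARD('n) \<ge> 2"
  shows "card {x\<in>lattice_D. \<exists>p\<in>polytope_D. (x :: real ^ 'n) = real k *\<^sub>R p} =
     card {z :: 'n \<Rightarrow> int. even (\<Sum>i\<in>UNIV. z i) \<and>
       (\<Sum>i\<in>UNIV. \<bar>z i\<bar>) \<le> 2 * int k \<and> (\<forall>i. \<bar>z i\<bar> \<le> int k)}"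
proof (rule card_lattice_dilate[OF lattice_D_def])
  fix z :: "'n \<Rightarrow> int"
  have "\<bar>real_of_int (z i)\<bar> \<le> real k \<longleftrightarrow> \<bar>z i\<bar> \<le> int k" for i
    by (metis of_int_abs of_int_le_iff of_int_of_nat_eq)
  then show "(\<exists>p\<in>polytope_D. (\<chi> i. real_of_int (z i)) = real k *\<^sub>R p) \<longleftrightarrow>
      (\<Sum>i\<in>UNIV. \<bar>z i\<bar>) \<le> 2 * int k \<and> (\<forall>i. \<bar>z i\<bar> \<le> int k)"
    by (simp add: dilate_polytope_D_iff[OF assms] l1_norm_of_int_le_iff)
qed

lemma card_lattice_A_dilate:
  assumes "CARD('n) \<ge> 2"
  shows "card {x\<in>lattice_A. \<exists>p\<in>polytope_A. (x :: real ^ 'n) = real k *\<^sub>R p} =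
     card {z :: 'n \<Rightarrow> int. (\<Sum>i\<in>UNIV. z i) = 0 \<and> (\<Sum>i\<in>UNIV. \<bar>z i\<bar>) \<le> 2 * int k}"
proof -
  have "card {x\<in>lattice_A. \<exists>p\<in>polytope_A. (x :: real ^ 'n) = real k *\<^sub>R p} =
     card {z :: 'n \<Rightarrow> int. (\<Sum>i\<in>UNIV. z i) = 0 \<and>
       ((\<Sum>i\<in>UNIV. z i) = 0 \<and> (\<Sum>i\<in>UNIV. \<bar>z i\<bar>) \<le> 2 * int k)}"
    by (rule card_lattice_dilate[OF lattice_A_def])
      (simp add: dilate_polytope_A_iff[OF assms] l1_norm_of_int_le_iff flip: of_int_sum)
  then show ?thesis by simp
qed

section \<open>Even vectors in a ball, and those with a large coordinate\<close>

lemma even_ball_eq_UN: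
  "{z :: 'n::finite \<Rightarrow> int. even (\<Sum>i\<in>UNIV. z i) \<and> (\<Sum>i\<in>UNIV. \<bar>z i\<bar>) \<le> 2 * int k} =
     (\<Union>s\<le>k. lattice_sphere UNIV UNIV (2 * s))"
proof (intro equalityI subsetI)
  fix z :: "'n \<Rightarrow> int"
  assume "z \<in> {z. even (\<Sum>i\<in>UNIV. z i) \<and> (\<Sum>i\<in>UNIV. \<bar>z i\<bar>) \<le> 2 * int k}"
  then have z: "even (\<Sum>i\<in>UNIV. \<bar>z i\<bar>)" "(\<Sum>i\<in>UNIV. \<bar>z i\<bar>) \<le> 2 * int k"
    by (auto simp: even_sum_abs_iff)
  from z(1) obtain m where m: "(\<Sum>i\<in>UNIV. \<bar>z i\<bar>) = 2 * m" by (rule evenE)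
  have "(\<Sum>i\<in>UNIV. \<bar>z i\<bar>) \<ge> 0" by (simp add: sum_nonneg)
  then have "m \<ge> 0" "m \<le> int k" using m z by auto
  then have "nat m \<le> k" "z \<in> lattice_sphere UNIV UNIV (2 * nat m)"
    using m by (auto simp: lattice_sphere_def)
  then show "z \<in> (\<Union>s\<le>k. lattice_sphere UNIV UNIV (2 * s))" by blast
next
  fix z :: "'n \<Rightarrow> int"
  assume "z \<in> (\<Union>s\<le>k. lattice_sphere UNIV UNIV (2 * s))"
  then obtain s where "s \<le> k" "(\<Sum>i\<in>UNIV. \<bar>z i\<bar>) = 2 * int s"
    by (auto simp: lattice_sphere_def)
  then show "z \<in> {z. even (\<Sum>i\<in>UNIV. z i) \<and> (\<Sum>i\<in>UNIV. \<bar>z i\<bar>) \<le> 2 * int k}"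
    using even_sum_abs_iff[of z UNIV] by auto
qed

lemma finite_even_ball:
  "finite {z :: 'n::finite \<Rightarrow> int. even (\<Sum>i\<in>UNIV. z i) \<and> (\<Sum>i\<in>UNIV. \<bar>z i\<bar>) \<le> 2 * int k}"
  unfolding even_ball_eq_UN by (simp add: finite_lattice_sphere)

lemma card_even_ball:
  "card {z :: 'n::finite \<Rightarrow> int. even (\<Sum>i\<in>UNIV. z i) \<and> (\<Sum>i\<in>UNIV. \<bar>z i\<bar>) \<le> 2 * int k} =
     even_ball_number CARD('n) k"
  unfolding even_ball_eq_UN even_ball_number_def
  by (subst card_UN_disjoint)
    (auto simp: finite_lattice_sphere card_lattice_sphere_UNIV, auto simp: lattice_sphere_def)

text \<open>Write the large modulus as 2k - q with q < k. The remaining coordinates then have norm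
  at most q and of the parity of q, and \<open>\<sigma>\<close> fixes the sign.\<close>

lemma card_large_coordinate:
  fixes i :: "'n::finite"
  assumes \<sigma>: "\<sigma> \<in> {1, -1 :: int}"
  shows "card {z. even (\<Sum>l\<in>UNIV. z l) \<and> (\<Sum>l\<in>UNIV. \<bar>z l\<bar>) \<le> 2 * int k \<and> \<sigma> * z i > int k} =
    (\<Sum>q<k. parity_ball_number (CARD('n) - 1) q)"
    (is "card ?B = _")
proof -
  let ?S = "\<lambda>r. lattice_sphere UNIV (UNIV - {i}) r"
  let ?D = "SIGMA q:{..<k}. SIGMA r:{r. r \<le> q \<and> even (q - r)}. ?S r"
  let ?f = "\<lambda>(q, r, y). y(i := \<sigma> * (2 * int k - int q))"
  let ?g = "\<lambda>z. (nat (2 * int k - \<bar>z i\<bar>), nat (\<Sum>l\<in>UNIV - {i}. \<bar>z l\<bar>), z(i := 0))"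
  have split: "(\<Sum>l\<in>UNIV. \<bar>z l\<bar>) = \<bar>z i\<bar> + (\<Sum>l\<in>UNIV - {i}. \<bar>z l\<bar>)" for z :: "'n \<Rightarrow> int"
    by (simp add: sum.remove[of _ i])
  have upd: "(\<Sum>l\<in>UNIV - {i}. \<bar>(z(i := x)) l\<bar>) = (\<Sum>l\<in>UNIV - {i}. \<bar>z l\<bar>)" for z :: "'n \<Rightarrow> int" and x
    by (rule sum.cong) auto
  have abs\<sigma>: "\<bar>\<sigma> * x\<bar> = \<bar>x\<bar>" for x using \<sigma> by auto
  have "bij_betw ?f ?D ?B"
  proof (rule bij_betw_byWitness[where f' = ?g])
    show "\<forall>d\<in>?D. ?g (?f d) = d"
      by (auto simp: upd[simplified] abs\<sigma> lattice_sphere_def fun_eq_iff)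
    show "\<forall>z\<in>?B. ?f (?g z) = z"
    proof
      fix z assume z: "z \<in> ?B"
      have nonneg: "0 \<le> (\<Sum>l\<in>UNIV - {i}. \<bar>z l\<bar>)" by (simp add: sum_nonneg)
      have "(\<Sum>l\<in>UNIV. \<bar>z l\<bar>) \<le> 2 * int k" using z by blast
      then have "\<bar>z i\<bar> \<le> 2 * int k" using nonneg split[of z] by linarith
      moreover have "\<sigma> * \<bar>z i\<bar> = z i" using z \<sigma> by auto
      ultimately show "?f (?g z) = z" by (auto simp: fun_eq_iff)
    qed
    show "?f ` ?D \<subseteq> ?B"
    proof (rule image_subsetI)
      fix d assume d: "d \<in> ?D"
      then obtain q r y where q: "d = (q, r, y)" "q < k" "r \<le> q" "even (q - r)" "y \<in> ?S r"
        by blast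
      let ?z = "y(i := \<sigma> * (2 * int k - int q))"
      have s: "(\<Sum>l\<in>UNIV. \<bar>?z l\<bar>) = 2 * int k - int q + int r"
        using q unfolding split[of ?z] upd by (simp add: abs\<sigma> lattice_sphere_def)
      have "even (int (q - r))" using q(4) by simp
      then have "even (int q - int r)" using q(3) by (simp add: of_nat_diff)
      then have "even (2 * int k - int q + int r)" by presburger
      then have "even (\<Sum>l\<in>UNIV. ?z l)"
        unfolding s[symmetric] even_sum_abs_iff .
      moreover have "(\<Sum>l\<in>UNIV. \<bar>?z l\<bar>) \<le> 2 * int k" unfolding s using q by simp
      moreover have "\<sigma> * ?z i > int k" using \<sigma> q by auto
      ultimately have "?z \<in> ?B" by blast
      then show "?f d \<in> ?B" by (simp add: q(1))
    qed
    show "?g ` ?B \<subseteq> ?D"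
    proof (rule image_subsetI)
      fix z assume z: "z \<in> ?B"
      define R where "R = (\<Sum>l\<in>UNIV - {i}. \<bar>z l\<bar>)"
      have R: "0 \<le> R" by (simp add: R_def sum_nonneg)
      have zi: "\<bar>z i\<bar> > int k" using z \<sigma> by auto
      have le: "\<bar>z i\<bar> + R \<le> 2 * int k" using z split[of z] by (simp add: R_def)
      have ev: "even (\<bar>z i\<bar> + R)"
        using z split[of z] even_sum_abs_iff[of z UNIV] by (simp add: R_def)
      have "int (nat (2 * int k - \<bar>z i\<bar>) - nat R) = 2 * int k - \<bar>z i\<bar> - R"
        using R le by linarith
      also have "even \<dots>" using ev by presburger
      finally have "even (nat (2 * int k - \<bar>z i\<bar>) - nat R)" by simp
      moreover have "z(i := 0) \<in> ?S (nat R)"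
        using R by (auto simp: lattice_sphere_def upd[simplified] R_def)
      moreover have "nat (2 * int k - \<bar>z i\<bar>) < k" "nat R \<le> nat (2 * int k - \<bar>z i\<bar>)"
        using zi le R by linarith+
      ultimately show "?g z \<in> ?D" by (simp add: R_def)
    qed
  qed
  then have "card ?B = card ?D" by (simp add: bij_betw_same_card)
  also have "\<dots> = (\<Sum>q<k. \<Sum>r | r \<le> q \<and> even (q - r). card (?S r))"
    by (simp add: finite_lattice_sphere)
  also have "\<dots> = (\<Sum>q<k. parity_ball_number (CARD('n) - 1) q)"
    by (simp add: card_lattice_sphere_UNIV parity_ball_number_def)
  finally show ?thesis .
qed

lemma card_even_ball_split:
  "card {z :: 'n::finite \<Rightarrow> int. even (\<Sum>i\<in>UNIV. z i) \<and> (\<Sum>i\<in>UNIV. \<bar>z i\<bar>) \<le> 2 * int k} =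
   card {z :: 'n \<Rightarrow> int. even (\<Sum>i\<in>UNIV. z i) \<and> (\<Sum>i\<in>UNIV. \<bar>z i\<bar>) \<le> 2 * int k \<and>
     (\<forall>i. \<bar>z i\<bar> \<le> int k)} +
   2 * CARD('n) * (\<Sum>q<k. parity_ball_number (CARD('n) - 1) q)"
    (is "card ?A = card ?G + _")
proof -
  let ?B = "\<lambda>(i, \<sigma>). {z :: 'n \<Rightarrow> int. even (\<Sum>l\<in>UNIV. z l) \<and>
    (\<Sum>l\<in>UNIV. \<bar>z l\<bar>) \<le> 2 * int k \<and> \<sigma> * z i > int k}"
  let ?I = "(UNIV :: 'n set) \<times> {1, -1 :: int}"
  have fin: "finite (?B p)" for p
    by (rule finite_subset[OF _ finite_even_ball[of k]]) auto
  have "?A = ?G \<union> (\<Union>p\<in>?I. ?B p)"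
  proof (intro equalityI subsetI)
    fix z assume z: "z \<in> ?A"
    show "z \<in> ?G \<union> (\<Union>p\<in>?I. ?B p)"
    proof (cases "\<forall>i. \<bar>z i\<bar> \<le> int k")
      case False
      then obtain i where "\<bar>z i\<bar> > int k" by (auto simp: not_le)
      then have "z \<in> ?B (i, if z i > 0 then 1 else -1)" using z by (auto simp: abs_if split: if_splits)
      then show ?thesis by (intro UnI2 UN_I[of "(i, if z i > 0 then 1 else -1)"]) auto
    qed (use z in auto)
  qed auto
  moreover have "?G \<inter> (\<Union>p\<in>?I. ?B p) = {}"
    by (auto simp: not_less abs_le_iff, (metis minus_minus neg_le_iff_le not_le)+)
  moreover have "finite ?G"
    by (rule finite_subset[OF _ finite_even_ball[of k]]) auto
  ultimately have "card ?A = card ?G + card (\<Union>p\<in>?I. ?B p)"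
    using fin by (simp add: card_Un_disjoint)
  also have "card (\<Union>p\<in>?I. ?B p) = (\<Sum>p\<in>?I. card (?B p))"
  proof (rule card_UN_disjoint)
    have False if "z \<in> ?B (i, s)" "z \<in> ?B (j, t)" "s \<in> {1, -1}" "t \<in> {1, -1}" "(i, s) \<noteq> (j, t)"
      for z i j s t
    proof (cases "i = j")
      case True
      with that show False by auto
    next
      case False
      have "(\<Sum>l\<in>{i, j}. \<bar>z l\<bar>) \<le> (\<Sum>l\<in>UNIV. \<bar>z l\<bar>)" by (rule sum_mono2) auto
      then have "\<bar>z i\<bar> + \<bar>z j\<bar> \<le> 2 * int k" using False that by simp
      moreover have "\<bar>z i\<bar> > int k" "\<bar>z j\<bar> > int k" using that by auto
      ultimately show False by linarith
    qed
    then show "\<forall>p\<in>?I. \<forall>q\<in>?I. p \<noteq> q \<longrightarrow> ?B p \<inter> ?B q = {}"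
      by fast
  qed (use fin in auto)
  also have "\<dots> = (\<Sum>p\<in>?I. \<Sum>q<k. parity_ball_number (CARD('n) - 1) q)"
    by (rule sum.cong[OF refl]) (clarsimp simp only: mem_Sigma_iff prod.case card_large_coordinate)
  also have "\<dots> = 2 * CARD('n) * (\<Sum>q<k. parity_ball_number (CARD('n) - 1) q)"
    by (simp add: card_cartesian_product)
  finally show ?thesis .
qed

section \<open>Zero-sum vectors and the count for type A\<close>

definition zero_sum_sphere :: "nat \<Rightarrow> ('i::finite \<Rightarrow> int) set" where
  "zero_sum_sphere r = {z. (\<Sum>i\<in>UNIV. z i) = 0 \<and> (\<Sum>i\<in>UNIV. \<bar>z i\<bar>) = 2 * int r}"

lemma finite_zero_sum_sphere: "finite (zero_sum_sphere r)"
  by (rule finite_subset[OF _ finite_lattice_sphere[of UNIV UNIV "2 * r"]])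
    (auto simp: zero_sum_sphere_def lattice_sphere_def)

text \<open>A pair of nonnegative vectors of equal sum is determined by its componentwise minimum and
  its difference, and these two can be prescribed independently.\<close>

lemma sum_card_zero_sum_sphere:
  assumes "CARD('i::finite) = Suc n"
  shows "(\<Sum>j\<le>s. ((n + j) choose n) * card (zero_sum_sphere (s - j) :: ('i \<Rightarrow> int) set)) =
    ((n + s) choose n)\<^sup>2"
proof -
  let ?S = "lattice_sphere {0..} (UNIV :: 'i set)"
  let ?D = "SIGMA j:{..s}. ?S j \<times> (zero_sum_sphere (s - j) :: ('i \<Rightarrow> int) set)"
  let ?f = "\<lambda>(a, b). (nat (\<Sum>i\<in>UNIV. min (a i) (b i)), \<lambda>i. min (a i) (b i), \<lambda>i. a i - b i)"
  let ?g = "\<lambda>(j, c, z). (\<lambda>i. c i + max (z i) 0, \<lambda>i. c i + max (- z i) 0)"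
  have S: "c \<in> ?S r \<longleftrightarrow> (\<forall>i. c i \<ge> 0) \<and> sum c UNIV = int r" for c :: "'i \<Rightarrow> int" and r
  proof -
    have "(\<Sum>i\<in>UNIV. \<bar>c i\<bar>) = sum c UNIV" if "\<forall>i. c i \<ge> 0"
      using that by (intro sum.cong) auto
    then show ?thesis by (auto simp: lattice_sphere_def)
  qed
  have "bij_betw ?f (?S s \<times> ?S s) ?D"
  proof (rule bij_betw_byWitness[where f' = ?g])
    show "\<forall>p\<in>?S s \<times> ?S s. ?g (?f p) = p"
      by (auto simp: fun_eq_iff min_def max_def)
    show "\<forall>d\<in>?D. ?f (?g d) = d"
    proof
      fix d assume "d \<in> ?D"
      then obtain j c z where d: "d = (j, c, z)" and c: "c \<in> ?S j" by blast
      have "min (c i + max (z i) 0) (c i + max (- z i) 0) = c i"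
        "c i + max (z i) 0 - (c i + max (- z i) 0) = z i" for i by auto
      then show "?f (?g d) = d"
        using c by (simp add: S d)
    qed
    show "?f ` (?S s \<times> ?S s) \<subseteq> ?D"
    proof (rule image_subsetI)
      fix p assume "p \<in> ?S s \<times> ?S s"
      then obtain a b where p: "p = (a, b)" and ab: "a \<in> ?S s" "b \<in> ?S s" by blast
      define m where "m = (\<Sum>i\<in>UNIV. min (a i) (b i))"
      have m: "m \<ge> 0" "m \<le> int s"
        using ab sum_mono[of UNIV "\<lambda>i. min (a i) (b i)" a] by (auto simp: S m_def intro!: sum_nonneg)
      have "\<bar>a i - b i\<bar> = a i + b i - 2 * min (a i) (b i)" for i by auto
      then have "(\<Sum>i\<in>UNIV. \<bar>a i - b i\<bar>) = 2 * int s - 2 * m"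
        using ab by (simp add: S m_def sum.distrib sum_subtractf flip: sum_distrib_left)
      then have "(\<lambda>i. a i - b i) \<in> zero_sum_sphere (s - nat m)"
        using ab m by (auto simp: zero_sum_sphere_def S sum_subtractf of_nat_diff nat_le_iff)
      moreover have "(\<lambda>i. min (a i) (b i)) \<in> ?S (nat m)"
        using ab m by (simp add: S m_def[symmetric])
      moreover have "nat m \<le> s" using m by simp
      ultimately show "?f p \<in> ?D" by (simp add: m_def p)
    qed
    show "?g ` ?D \<subseteq> ?S s \<times> ?S s"
    proof (rule image_subsetI)
      fix d assume "d \<in> ?D"
      then obtain j c z where d: "d = (j, c, z)" and j: "j \<le> s" and c: "c \<in> ?S j"
        and z: "z \<in> zero_sum_sphere (s - j)" by blast
      have "2 * max (z i) 0 = \<bar>z i\<bar> + z i" "2 * max (- z i) 0 = \<bar>z i\<bar> - z i" for i by auto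
      then have "2 * (\<Sum>i\<in>UNIV. max (z i) 0) = (\<Sum>i\<in>UNIV. \<bar>z i\<bar>) + sum z UNIV"
        "2 * (\<Sum>i\<in>UNIV. max (- z i) 0) = (\<Sum>i\<in>UNIV. \<bar>z i\<bar>) - sum z UNIV"
        by (simp_all add: sum_distrib_left sum.distrib sum_subtractf)
      then have "(\<Sum>i\<in>UNIV. max (z i) 0) = int s - int j" "(\<Sum>i\<in>UNIV. max (- z i) 0) = int s - int j"
        using z j by (auto simp: zero_sum_sphere_def of_nat_diff)
      then show "?g d \<in> ?S s \<times> ?S s"
        using c j unfolding d by (auto simp: S sum.distrib)
    qed
  qed
  then have "card ?D = card (?S s \<times> ?S s)" by (simp add: bij_betw_same_card)
  moreover have "card ?D = (\<Sum>j\<le>s. card (?S j \<times> (zero_sum_sphere (s - j) :: ('i \<Rightarrow> int) set)))"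
    by (rule card_SigmaI) (auto intro!: finite_cartesian_product finite_lattice_sphere finite_zero_sum_sphere)
  ultimately show ?thesis
    by (simp add: card_cartesian_product card_lattice_sphere_nonneg[OF finite assms] power2_eq_square)
qed

lemma card_zero_sum_ball:
  "card {z :: 'i::finite \<Rightarrow> int. (\<Sum>i\<in>UNIV. z i) = 0 \<and> (\<Sum>i\<in>UNIV. \<bar>z i\<bar>) \<le> 2 * int k} =
     (\<Sum>r\<le>k. card (zero_sum_sphere r :: ('i \<Rightarrow> int) set))"
proof -
  have "{z :: 'i \<Rightarrow> int. (\<Sum>i\<in>UNIV. z i) = 0 \<and> (\<Sum>i\<in>UNIV. \<bar>z i\<bar>) \<le> 2 * int k} =
      (\<Union>r\<le>k. zero_sum_sphere r)"
  proof (intro equalityI subsetI)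
    fix z :: "'i \<Rightarrow> int"
    assume z: "z \<in> {z. (\<Sum>i\<in>UNIV. z i) = 0 \<and> (\<Sum>i\<in>UNIV. \<bar>z i\<bar>) \<le> 2 * int k}"
    \<comment> \<open>Zero is even, so the decomposition of the even ball applies and the norm is of
      the form 2r; positive and negative parts each have sum r.\<close>
    then have "z \<in> (\<Union>s\<le>k. lattice_sphere UNIV UNIV (2 * s))"
      unfolding even_ball_eq_UN[symmetric] by simp
    with z show "z \<in> (\<Union>r\<le>k. zero_sum_sphere r)"
      by (auto simp: lattice_sphere_def zero_sum_sphere_def)
  qed (auto simp: zero_sum_sphere_def)
  then show ?thesis
    by (simp only:, subst card_UN_disjoint)
      (auto simp: finite_zero_sum_sphere, auto simp: zero_sum_sphere_def)
qed

text \<open>Partial sums are multiplication by 1 / (1 - t), which can be moved across a product of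
  series.\<close>

lemma sum_convolution_partial_sums:
  fixes w z :: "nat \<Rightarrow> nat"
  shows "(\<Sum>j\<le>s. w j * (\<Sum>r\<le>s - j. z r)) = (\<Sum>t\<le>s. \<Sum>j\<le>t. w j * z (t - j))"
proof (induction s)
  case (Suc s)
  have "(\<Sum>j\<le>Suc s. w j * (\<Sum>r\<le>Suc s - j. z r)) =
      (\<Sum>j\<le>s. w j * ((\<Sum>r\<le>s - j. z r) + z (Suc s - j))) + w (Suc s) * z 0"
    by (simp add: Suc_diff_le)
  also have "\<dots> = (\<Sum>j\<le>s. w j * (\<Sum>r\<le>s - j. z r)) + (\<Sum>j\<le>Suc s. w j * z (Suc s - j))"
    by (simp add: algebra_simps sum.distrib)
  finally show ?case using Suc by simp
qed simp

text \<open>A power series with constant term 1 can be cancelled.\<close>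

lemma convolution_inject:
  fixes w f g :: "nat \<Rightarrow> nat"
  assumes "w 0 = 1" "\<And>s. (\<Sum>j\<le>s. w j * f (s - j)) = (\<Sum>j\<le>s. w j * g (s - j))"
  shows "f s = g s"
proof (induction s rule: less_induct)
  case (less s)
  have split: "(\<Sum>j\<le>s. w j * h (s - j)) = h s + (\<Sum>j\<in>{1..s}. w j * h (s - j))" for h
    using assms(1) by (simp add: atMost_atLeast0 sum.atLeast_Suc_atMost)
  have "(\<Sum>j\<in>{1..s}. w j * f (s - j)) = (\<Sum>j\<in>{1..s}. w j * g (s - j))"
    by (rule sum.cong) (auto intro!: less)
  then show ?case using assms(2)[of s] unfolding split by simp
qed

text \<open>The product of 1 / (1 - t)^(n+1) and t^m / (1 - t)^(m+1).\<close>

lemma sum_choose_convolution: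
  "(\<Sum>j\<le>s. ((n + j) choose n) * ((s - j) choose m)) = Suc (n + s) choose Suc (n + m)"
proof (induction s arbitrary: m)
  case 0
  show ?case by (cases m) auto
next
  case (Suc s)
  show ?case
  proof (cases m)
    case 0
    then show ?thesis using choose_rising_sum(1)[of n "Suc s"] by simp
  next
    case (Suc l)
    have "(\<Sum>j\<le>Suc s. ((n + j) choose n) * ((Suc s - j) choose Suc l)) =
        (\<Sum>j\<le>s. ((n + j) choose n) * (((s - j) choose l) + ((s - j) choose Suc l)))"
      by (simp add: Suc_diff_le)
    also have "\<dots> = (Suc (n + s) choose Suc (n + l)) + (Suc (n + s) choose Suc (n + Suc l))"
      by (simp only: distrib_left sum.distrib Suc.IH)
    finally show ?thesis using Suc by simp
  qed
qed

text \<open>Choosing nested subsets in either order extracts one factor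
  \<open>(n + s) choose n\<close>; Vandermonde's identity supplies the other.\<close>

lemma sum_choose_square:
  "(\<Sum>m\<le>n. ((n + m) choose m) * (n choose m) * ((n + s) choose (n + m))) = ((n + s) choose n)\<^sup>2"
proof -
  have "((n + m) choose m) * (n choose m) * ((n + s) choose (n + m)) =
      ((n + s) choose n) * ((s choose m) * (n choose (n - m)))" if "m \<le> n" for m
  proof (cases "m \<le> s")
    case True
    have "((n + s) choose (n + m)) * ((n + m) choose n) = ((n + s) choose n) * (s choose m)"
      using choose_mult[of n "n + m" "n + s"] True by simp
    moreover have "(n + m) choose m = (n + m) choose n"
      using binomial_symmetric[of m "n + m"] by simp
    moreover have "n choose m = n choose (n - m)"
      by (rule binomial_symmetric[OF that])
    ultimately show ?thesis by (simp add: algebra_simps)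
  qed (simp add: binomial_eq_0)
  then have "(\<Sum>m\<le>n. ((n + m) choose m) * (n choose m) * ((n + s) choose (n + m))) =
      ((n + s) choose n) * (\<Sum>m\<le>n. (s choose m) * (n choose (n - m)))"
    by (simp add: sum_distrib_left)
  also have "(\<Sum>m\<le>n. (s choose m) * (n choose (n - m))) = (n + s) choose n"
    using vandermonde[of s n n] by (simp add: add.commute)
  finally show ?thesis by (simp add: power2_eq_square)
qed

text \<open>Both sides are compared after convolution with \<open>(n + j) choose n\<close>, the
  number of choices for the common minimum: this turns the left side into a sum of squares and can
  be undone.\<close>

lemma card_zero_sum_ball_eq:
  assumes "CARD('i::finite) = Suc n"
  shows "card {z :: 'i \<Rightarrow> int. (\<Sum>i\<in>UNIV. z i) = 0 \<and> (\<Sum>i\<in>UNIV. \<bar>z i\<bar>) \<le> 2 * int k} =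
     (\<Sum>m\<le>n. ((n + m) choose m) * (n choose m) * (k choose m))"
  unfolding card_zero_sum_ball
proof (rule convolution_inject[where w = "\<lambda>j. (n + j) choose n" and s = k
      and f = "\<lambda>k. \<Sum>r\<le>k. card (zero_sum_sphere r :: ('i \<Rightarrow> int) set)"
      and g = "\<lambda>k. \<Sum>m\<le>n. ((n + m) choose m) * (n choose m) * (k choose m)"])
  fix s
  let ?c = "\<lambda>m. ((n + m) choose m) * (n choose m)"
  have "(\<Sum>j\<le>s. ((n + j) choose n) * (\<Sum>r\<le>s - j. card (zero_sum_sphere r :: ('i \<Rightarrow> int) set))) =
      (\<Sum>t\<le>s. ((n + t) choose n)\<^sup>2)"
    unfolding sum_convolution_partial_sums by (simp add: sum_card_zero_sum_sphere[OF assms])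
  \<comment> \<open>The square identity summed over t: Pascal's rule raises both binomial indices by
    one.\<close>
  also have "\<dots> = (\<Sum>m\<le>n. ?c m * (Suc (n + s) choose Suc (n + m)))"
  proof (induction s)
    case 0
    have "(\<Sum>m\<le>n. ?c m * (Suc (n + 0) choose Suc (n + m))) = (\<Sum>m\<le>n. if m = 0 then 1 else 0)"
      by (rule sum.cong) (auto simp: binomial_eq_0)
    then show ?case by simp
  next
    case (Suc s)
    have "(\<Sum>m\<le>n. ?c m * (Suc (n + Suc s) choose Suc (n + m))) =
        (\<Sum>m\<le>n. ?c m * ((n + Suc s) choose (n + m))) + (\<Sum>m\<le>n. ?c m * (Suc (n + s) choose Suc (n + m)))"
      unfolding binomial_Suc_Suc[of "n + Suc s"] distrib_left sum.distrib by simp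
    then show ?case unfolding sum_choose_square using Suc by simp
  qed
  also have "\<dots> = (\<Sum>m\<le>n. ?c m * (\<Sum>j\<le>s. ((n + j) choose n) * ((s - j) choose m)))"
    unfolding sum_choose_convolution ..
  also have "\<dots> = (\<Sum>j\<le>s. ((n + j) choose n) * (\<Sum>m\<le>n. ?c m * ((s - j) choose m)))"
    unfolding sum_distrib_left by (subst sum.swap) (simp add: ac_simps)
  finally show "(\<Sum>j\<le>s. ((n + j) choose n) * (\<Sum>r\<le>s - j. card (zero_sum_sphere r :: ('i \<Rightarrow> int) set))) =
      (\<Sum>j\<le>s. ((n + j) choose n) * (\<Sum>m\<le>n. ?c m * ((s - j) choose m)))" .
qed simp

section \<open>The three f-polynomials\<close>

lemma f_polynomial_A:
  fixes T :: "(real ^ 'n) set set"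
  assumes n: "n \<ge> 1" "CARD('n) = n + 1"
    and T: "unimodular_boundary_triangulation lattice_A polytope_A T"
  shows "f_polynomial T =
    (\<Sum>m = 0..n. monom (fact (n + m) / (fact m * fact m * fact (n - m))) (n - m))"
proof -
  interpret unimodular_boundary lattice_A polytope_A T
    by (rule unimodular_boundary_A) (use n T in auto)
  \<comment> \<open>The multinomial coefficient as a product of binomials, which vanishes for
    \<open>m > n\<close> without a case distinction.\<close>
  let ?F = "\<lambda>m. real (((n + m) choose m) * (n choose m))"
  have "f_polynomial T = (\<Sum>m = 0..n. monom (?F m) (n - m))"
  proof (rule f_polynomial_eqI)
    fix k
    have "card {x\<in>lattice_A. \<exists>p\<in>polytope_A. (x :: real ^ 'n) = real k *\<^sub>R p} =
        (\<Sum>m\<le>n. ((n + m) choose m) * (n choose m) * (k choose m))"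
      using card_lattice_A_dilate[where 'n = 'n, of k] card_zero_sum_ball_eq[where 'i = 'n, of n k] n
      by simp
    then show "real (card {x\<in>lattice_A. \<exists>p\<in>polytope_A. (x :: real ^ 'n) = real k *\<^sub>R p}) = newton ?F k"
      by (subst newton_eq_sum[of n]) (simp_all add: binomial_eq_0)
  qed (simp_all add: binomial_eq_0)
  also have "\<dots> = (\<Sum>m = 0..n. monom (fact (n + m) / (fact m * fact m * fact (n - m))) (n - m))"
  proof (rule sum.cong)
    fix m assume "m \<in> {0..n}"
    then have "?F m = fact (n + m) / (fact m * fact m * fact (n - m))"
      by (simp add: binomial_fact field_simps)
    then show "monom (?F m) (n - m) = monom (fact (n + m) / (fact m * fact m * fact (n - m))) (n - m)"
      by simp
  qed simp
  finally show ?thesis .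
qed

lemma chebyshev_coeff_eq_0: "m > n \<Longrightarrow> chebyshev_coeff n m = 0"
  by (simp add: chebyshev_coeff_def binomial_eq_0)

lemma f_polynomial_C:
  fixes T :: "(real ^ 'n) set set"
  assumes n: "n \<ge> 1" "CARD('n) = n"
    and T: "unimodular_boundary_triangulation lattice_C polytope_C T"
  shows "f_polynomial T =
    (\<Sum>m = 0..n. monom (real n * 2 ^ (2 * m) / real (n + m) * real ((n + m) choose (2 * m))) (n - m))"
proof -
  interpret unimodular_boundary lattice_C polytope_C T
    by (rule unimodular_boundary_C[OF T])
  have "f_polynomial T = (\<Sum>m = 0..n. monom (chebyshev_coeff n m) (n - m))"
  proof (rule f_polynomial_eqI)
    show "chebyshev_coeff n n \<noteq> 0"
      using n by (simp add: chebyshev_coeff_def flip: mult_2)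
    fix k
    show "real (card {x\<in>lattice_C. \<exists>p\<in>polytope_C. (x :: real ^ 'n) = real k *\<^sub>R p}) =
        newton (chebyshev_coeff n) k"
      by (simp add: card_lattice_C_dilate card_even_ball even_ball_number_eq n)
  qed (rule chebyshev_coeff_eq_0)
  then show ?thesis by (simp only: chebyshev_coeff_eq[OF n(1)])
qed

lemma root_D_coeff_eq:
  assumes "n \<ge> 2" "m \<le> n"
  shows "root_D_coeff n m =
    real n * 2 ^ (2 * m) / real (n + m) * real ((n + m) choose (2 * m)) - c_corr n m"
proof (cases m)
  case 0
  with assms show ?thesis by (simp add: root_D_coeff_def c_corr_def)
next
  case (Suc l)
  then have "c_corr n m = 2 * real n * parity_coeff (n - 2) l"
    using c_corr_Suc_eq[of n l] assms by simp
  then show ?thesis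
    using chebyshev_coeff_eq[of n m] assms Suc by (simp add: root_D_coeff_def)
qed

text \<open>Secures the dimension of the complex: the top coefficient equals 2^(n-1) (2^n -
  n).\<close>

lemma root_D_coeff_top:
  assumes "n \<ge> 2"
  shows "root_D_coeff n n > 0"
proof -
  have c: "root_D_coeff n n = 2 ^ (2 * n) / 2 - real n * 2 ^ (n - 1)"
    using assms by (simp add: root_D_coeff_eq c_corr_def flip: mult_2)
  have "2 ^ (2 * n) / 2 = (2 :: real) ^ n * 2 ^ (n - 1)"
    using assms by (simp add: power_even_eq power2_eq_square power_eq_if[of _ n])
  moreover have "real n * 2 ^ (n - 1) < (2 :: real) ^ n * 2 ^ (n - 1)"
    using of_nat_less_two_power[of n] by (intro mult_strict_right_mono) auto
  ultimately show ?thesis using c by simp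
qed

lemma f_polynomial_D:
  fixes T :: "(real ^ 'n) set set"
  assumes n: "n \<ge> 2" "CARD('n) = n"
    and T: "unimodular_boundary_triangulation lattice_D polytope_D T"
  shows "f_polynomial T =
    (\<Sum>m = 0..n. monom (real n * 2 ^ (2 * m) / real (n + m)
       * real ((n + m) choose (2 * m)) - c_corr n m) (n - m))"
proof -
  interpret unimodular_boundary lattice_D polytope_D T
    by (rule unimodular_boundary_D) (use n T in auto)
  have "f_polynomial T = (\<Sum>m = 0..n. monom (root_D_coeff n m) (n - m))"
  proof (rule f_polynomial_eqI)
    show "root_D_coeff n n \<noteq> 0" using root_D_coeff_top[OF n(1)] by simp
    show "root_D_coeff n m = 0" if "m > n" for m
      using that n(1) by (auto simp: root_D_coeff_def chebyshev_coeff_eq_0 parity_coeff_def binomial_eq_0)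
    fix k
    let ?c = "card {x\<in>lattice_D. \<exists>p\<in>polytope_D. (x :: real ^ 'n) = real k *\<^sub>R p}"
    \<comment> \<open>The remaining coordinates number at least one, as the parity ball formula
      demands.\<close>
    have "n - 1 = Suc (n - 2)" using n by simp
    moreover have "even_ball_number n k = ?c + 2 * n * (\<Sum>q<k. parity_ball_number (n - 1) q)"
      using card_even_ball_split[where 'n = 'n, of k] card_lattice_D_dilate[where 'n = 'n, of k] n
      by (simp add: card_even_ball)
    ultimately have "real ?c = real (even_ball_number n k) -
        2 * real n * (\<Sum>q<k. real (parity_ball_number (Suc (n - 2)) q))"
      by simp
    also have "\<dots> = newton (chebyshev_coeff n) k -
        newton (\<lambda>m. 2 * real n * (if m = 0 then 0 else parity_coeff (n - 2) (m - 1))) k"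
      by (simp add: even_ball_number_eq sum_parity_ball_number newton_cmult)
    also have "\<dots> = newton (root_D_coeff n) k"
      unfolding root_D_coeff_def newton_diff[symmetric]
      by (rule arg_cong[where f = "\<lambda>a. newton a k"]) auto
    finally show "real ?c = newton (root_D_coeff n) k" .
  qed
  also have "\<dots> = (\<Sum>m = 0..n. monom (real n * 2 ^ (2 * m) / real (n + m)
       * real ((n + m) choose (2 * m)) - c_corr n m) (n - m))"
    by (rule sum.cong) (use root_D_coeff_eq[OF n(1)] in auto)
  finally show ?thesis .
qed

theorem theorem1:
  shows "(\<forall>n (T :: (real ^ 'a) set set).
            n \<ge> 1 \<and> CARD('a) = n + 1 \<and>
            unimodular_boundary_triangulation lattice_A polytope_A T \<longrightarrow>
            f_polynomial T =
              (\<Sum>m = 0..n. monom (fact (n + m) / (fact m * fact m * fact (n - m))) (n - m)))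
       \<and> (\<forall>n (T :: (real ^ 'c) set set).
            n \<ge> 1 \<and> CARD('c) = n \<and>
            unimodular_boundary_triangulation lattice_C polytope_C T \<longrightarrow>
            f_polynomial T =
              (\<Sum>m = 0..n. monom (real n * 2 ^ (2 * m) / real (n + m)
                 * real ((n + m) choose (2 * m))) (n - m)))
       \<and> (\<forall>n (T :: (real ^ 'd) set set).
            n \<ge> 2 \<and> CARD('d) = n \<and>
            unimodular_boundary_triangulation lattice_D polytope_D T \<longrightarrow>
            f_polynomial T =
              (\<Sum>m = 0..n. monom (real n * 2 ^ (2 * m) / real (n + m)
                 * real ((n + m) choose (2 * m)) - c_corr n m) (n - m)))"
  using f_polynomial_A f_polynomial_C f_polynomial_D by blast

end
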